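(* Let $n\ge 2$ be an integer that is not a prime power. Then there exists a continuous map $f:\partial\Delta^{n-1}\to\Delta^{n-1}$ whose image does not contain the center $c=(1/n,\dots,1/n)$, which is pseudo-equivariant, that is, $f(\sigma_{FGZ}(x))=\sigma_{FGZ}(f(x))$ for every pair of proper faces $F,G$ of $\Delta^{n-1}$ of equal dimension, every bijection $Z$ between their sets of zero coordinates, and every $x\in F$, and which has zero linking number with the center $c$.
   Context: $\Delta^{n-1}=\{(t_1,\dots,t_n)\in\mathbb R^n : t_1,\dots,t_n\ge 0,\ t_1+\dots+t_n=1\}$, and $\partial\Delta^{n-1}$ is its boundary (the points with at least one zero coordinate). For a nonempty set $I\subsetneq\{1,\dots,n\}$, the corresponding (nonempty) proper face is $F_I=\{t\in\Delta^{n-1} : t_i=0 \text{ for all } i\notin I\}$; its "nonzero coordinates" are those indexed by $I$ and its "zero coordinates" are those indexed by $\{1,\dots,n\}\setminus I$. The dimension of $F_I$ is $|I|-1$. Definition of $\sigma_{FGZ}$: let $F=F_I$ and $G=F_J$ be proper faces with $|I|=|J|$ (the case $F=G$ is allowed), and let $Z:\{1,\dots,n\}\setminus I\to\{1,\dots,n\}\setminus J$ be an arbitrary bijection. Let $\pi$ be the permutation of $\{1,\dots,n\}$ which restricts to the unique order-preserving bijection $I\to J$ and which equals $Z$ on $\{1,\dots,n\}\setminus I$. Then $\sigma_{FGZ}:\Delta^{n-1}\to\Delta^{n-1}$ is the permutation of coordinates given by $(\sigma_{FGZ}(t))_{\pi(i)}=t_i$ for all $i$. It maps $F$ onto $G$.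 The linking number of a continuous map $f:\partial\Delta^{n-1}\to\Delta^{n-1}\setminus\{c\}$ with $c$ is the mapping degree of the composition of $f$ with the central projection $\Delta^{n-1}\setminus\{c\}\to\partial\Delta^{n-1}$ from $c$, where $\partial\Delta^{n-1}$ is regarded as an oriented $(n-2)$-sphere. *)

theory Defs
  imports "HOL-Analysis.Analysis" "HOL-Homology.Homology"
    "HOL-Number_Theory.Prime_Powers"
begin

text \<open>
  The simplex \<open>\<Delta>\<^sup>n\<^sup>-\<^sup>1\<close> lives in \<^typ>\<open>real^'n\<close> with \<open>n = CARD('n)\<close>. The index type \<^typ>\<open>'n\<close> is finite
  and linearly ordered, so it plays the role of \<open>{1,\<dots>,n}\<close> with its usual order; the order enters
  only through the order-preserving bijections between the vertex sets of faces.
\<close>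

definition unit_simplex :: "(real^'n) set" where
  "unit_simplex = {t. (\<forall>i. t $ i \<ge> 0) \<and> (\<Sum>i\<in>UNIV. t $ i) = 1}"

definition simplex_boundary :: "(real^'n) set" where
  "simplex_boundary = {t \<in> unit_simplex. \<exists>i. t $ i = 0}"

definition simplex_center :: "real^'n" where
  "simplex_center = (\<chi> i. 1 / real CARD('n))"

definition simplex_face :: "'n set \<Rightarrow> (real^'n) set" where
  "simplex_face I = {t \<in> unit_simplex. \<forall>i. i \<notin> I \<longrightarrow> t $ i = 0}"


subsection \<open>Pseudo-equivariance\<close>

text \<open>Only the values of \<open>Z\<close> on \<open>- I\<close> matter.\<close>

definition face_perm :: "'n::{finite,linorder} set \<Rightarrow> 'n set \<Rightarrow> ('n \<Rightarrow> 'n) \<Rightarrow> 'n \<Rightarrow> 'n" where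
  "face_perm I J Z =
     (THE \<pi>. bij_betw \<pi> I J \<and> strict_mono_on I \<pi> \<and> (\<forall>i. i \<notin> I \<longrightarrow> \<pi> i = Z i))"

text \<open>\<open>(\<sigma> t)\<^sub>j = t\<^bsub>\<pi>\<^sup>-\<^sup>1(j)\<^esub>\<close>, that is, \<open>(\<sigma> t)\<^bsub>\<pi>(i)\<^esub> = t\<^sub>i\<close>.\<close>

definition face_sigma ::
  "'n::{finite,linorder} set \<Rightarrow> 'n set \<Rightarrow> ('n \<Rightarrow> 'n) \<Rightarrow>
    real^'n::{finite,linorder} \<Rightarrow> real^'n::{finite,linorder}" where
  "face_sigma I J Z t = (\<chi> j. t $ inv_into UNIV (face_perm I J Z) j)"

definition pseudo_equivariant ::
  "(real^'n::{finite,linorder} \<Rightarrow> real^'n::{finite,linorder}) \<Rightarrow> bool" where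
  "pseudo_equivariant f \<longleftrightarrow>
     (\<forall>I J Z. I \<noteq> {} \<and> I \<noteq> UNIV \<and> J \<noteq> {} \<and> J \<noteq> UNIV \<and> card I = card J \<and>
        bij_betw Z (- I) (- J) \<longrightarrow>
        (\<forall>x \<in> simplex_face I. f (face_sigma I J Z x) = face_sigma I J Z (f x)))"

lemma ex1_face_perm:
  fixes I J :: "'n::{finite,linorder} set"
  assumes "card I = card J"
  shows "\<exists>!\<pi>. bij_betw \<pi> I J \<and> strict_mono_on I \<pi> \<and> (\<forall>i. i \<notin> I \<longrightarrow> \<pi> i = Z i)"
proof (rule ex_ex1I)
  have "\<exists>\<rho>. bij_betw \<rho> I J \<and> strict_mono_on I \<rho>"
    using finite [of I] assms
  proof (induction I arbitrary: J rule: finite_linorder_max_induct)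
    case empty
    then show ?case by (auto simp: bij_betw_def strict_mono_on_def)
  next
    case (insert b A)
    have bA: "b \<notin> A" using insert.hyps by auto
    then have "card J = Suc (card A)" using insert by simp
    then have "J \<noteq> {}" by auto
    define M where "M = Max J"
    have M: "M \<in> J" "\<And>j. j \<in> J \<Longrightarrow> j \<le> M"
      using \<open>J \<noteq> {}\<close> by (auto simp: M_def)
    have "card A = card (J - {M})"
      using M \<open>card J = _\<close> by simp
    from insert.IH [OF this] obtain \<rho> where \<rho>: "bij_betw \<rho> A (J - {M})" "strict_mono_on A \<rho>"
      by blast
    have "\<rho> a < M" if "a \<in> A" for a
    proof -
      have "\<rho> a \<in> J - {M}" using \<rho>(1) that by (auto simp: bij_betw_def)
      then show ?thesis using M(2) [of "\<rho> a"] by auto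
    qed
    then have "strict_mono_on (insert b A) (\<rho>(b := M))"
      using \<rho>(2) insert.hyps bA by (auto simp: strict_mono_on_def dest: less_asym)
    moreover have "bij_betw (\<rho>(b := M)) (insert b A) (insert M (J - {M}))"
    proof -
      have "bij_betw (\<rho>(b := M)) A (J - {M})"
        using \<rho>(1) bA bij_betw_cong [of A "\<rho>(b := M)" \<rho> "J - {M}"] by fastforce
      then show ?thesis
        using bA notIn_Un_bij_betw [of b A "\<rho>(b := M)" "J - {M}"] by simp
    qed
    ultimately show ?case
      using M(1) by (metis insert_Diff)
  qed
  then obtain \<rho> where \<rho>: "bij_betw \<rho> I J" "strict_mono_on I \<rho>" by blast
  let ?\<pi> = "\<lambda>i. if i \<in> I then \<rho> i else Z i"
  have "bij_betw ?\<pi> I J" using \<rho>(1) bij_betw_cong [of I ?\<pi> \<rho>] by auto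
  moreover have "strict_mono_on I ?\<pi>" using \<rho>(2) by (auto simp: strict_mono_on_def)
  ultimately show "\<exists>\<pi>. bij_betw \<pi> I J \<and> strict_mono_on I \<pi> \<and> (\<forall>i. i \<notin> I \<longrightarrow> \<pi> i = Z i)"
    by (intro exI [of _ ?\<pi>]) auto
next
  have le: "\<pi> i \<le> \<pi>' i"
    if \<pi>: "bij_betw \<pi> I J" "strict_mono_on I \<pi>" and \<pi>': "bij_betw \<pi>' I J" "strict_mono_on I \<pi>'"
      and "i \<in> I" and IH: "\<And>k. k \<in> I \<Longrightarrow> k < i \<Longrightarrow> \<pi> k = \<pi>' k"
    for \<pi> \<pi>' :: "'n \<Rightarrow> 'n" and i
  proof (rule ccontr)
    assume "\<not> \<pi> i \<le> \<pi>' i"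
    then have less: "\<pi>' i < \<pi> i" by simp
    have "\<pi>' i \<in> J" using \<pi>' \<open>i \<in> I\<close> by (auto simp: bij_betw_def)
    then obtain k where k: "k \<in> I" "\<pi>' i = \<pi> k" using \<pi> by (auto simp: bij_betw_def)
    then have "k < i"
      using \<pi>(2) less \<open>i \<in> I\<close> by (metis linorder_neqE order_less_asym strict_mono_onD)
    then have "\<pi>' k = \<pi>' i" using IH k by simp
    then show False
      using strict_mono_onD [OF \<pi>'(2) k(1) \<open>i \<in> I\<close> \<open>k < i\<close>] by simp
  qed
  fix \<pi> \<pi>'
  assume 1: "bij_betw \<pi> I J \<and> strict_mono_on I \<pi> \<and> (\<forall>i. i \<notin> I \<longrightarrow> \<pi> i = Z i)"
    and 2: "bij_betw \<pi>' I J \<and> strict_mono_on I \<pi>' \<and> (\<forall>i. i \<notin> I \<longrightarrow> \<pi>' i = Z i)"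
  have "\<pi> i = \<pi>' i" if "i \<in> I" for i
  proof (rule ccontr)
    assume "\<pi> i \<noteq> \<pi>' i"
    define S where "S = {i \<in> I. \<pi> i \<noteq> \<pi>' i}"
    have "S \<noteq> {}" using that \<open>\<pi> i \<noteq> \<pi>' i\<close> by (auto simp: S_def)
    then have "Min S \<in> S" by simp
    moreover have "\<pi> k = \<pi>' k" if "k \<in> I" "k < Min S" for k
    proof (rule ccontr)
      assume "\<pi> k \<noteq> \<pi>' k"
      then have "Min S \<le> k" using that by (intro Min_le) (auto simp: S_def)
      then show False using that by simp
    qed
    ultimately have "\<pi> (Min S) = \<pi>' (Min S)"
      using le [of \<pi> \<pi>' "Min S"] le [of \<pi>' \<pi> "Min S"] 1 2
      by (metis (mono_tags, lifting) S_def antisym mem_Collect_eq)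
    with \<open>Min S \<in> S\<close> show False by (simp add: S_def)
  qed
  with 1 2 show "\<pi> = \<pi>'" by (metis ext)
qed

lemma face_perm:
  fixes I J :: "'n::{finite,linorder} set"
  assumes "card I = card J" "bij_betw Z (- I) (- J)"
  shows "bij (face_perm I J Z)" "bij_betw (face_perm I J Z) I J"
    "strict_mono_on I (face_perm I J Z)" "\<And>i. i \<notin> I \<Longrightarrow> face_perm I J Z i = Z i"
    "face_sigma I J Z t $ face_perm I J Z i = t $ i"
proof -
  note * = theI' [OF ex1_face_perm [OF assms(1), of Z], folded face_perm_def]
  show 1: "bij_betw (face_perm I J Z) I J" and "strict_mono_on I (face_perm I J Z)"
    and 2: "\<And>i. i \<notin> I \<Longrightarrow> face_perm I J Z i = Z i"
    using * by blast+
  have "bij_betw (face_perm I J Z) (- I) (- J)"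
    using assms(2) 2 bij_betw_cong [of "- I" "face_perm I J Z" Z "- J"] by auto
  with 1 have "bij_betw (face_perm I J Z) (I \<union> - I) (J \<union> - J)"
    by (intro bij_betw_combine) auto
  then show 3: "bij (face_perm I J Z)"
    by simp
  show "face_sigma I J Z t $ face_perm I J Z i = t $ i"
    using 3 by (simp add: face_sigma_def bij_is_inj)
qed


subsection \<open>Mapping degree and linking number\<close>

text \<open>
  The degree of a self-map of a space \<open>X\<close> homeomorphic to the standard \<open>p\<close>-sphere, obtained from the
  degree of self-maps of \<^const>\<open>nsphere\<close> by transport along a homeomorphism. Neither the choice of the
  homeomorphism nor that of an orientation of \<open>X\<close> matters, see \<open>sphere_degree_eq\<close>.
\<close>

definition sphere_degree :: "nat \<Rightarrow> 'a topology \<Rightarrow> ('a \<Rightarrow> 'a) \<Rightarrow> int" where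
  "sphere_degree p X f =
     (THE d. \<exists>g h. homeomorphic_maps X (nsphere p) g h \<and> d = Brouwer_degree2 p (g \<circ> f \<circ> h))"

lemma sphere_degree_eq:
  assumes f: "continuous_map X X f" and gh: "homeomorphic_maps X (nsphere p) g h"
  shows "sphere_degree p X f = Brouwer_degree2 p (g \<circ> f \<circ> h)"
  unfolding sphere_degree_def
proof (rule the_equality)
  show "\<exists>g' h'. homeomorphic_maps X (nsphere p) g' h' \<and>
    Brouwer_degree2 p (g \<circ> f \<circ> h) = Brouwer_degree2 p (g' \<circ> f \<circ> h')"
    using gh by blast
next
  fix d assume "\<exists>g' h'. homeomorphic_maps X (nsphere p) g' h' \<and> d = Brouwer_degree2 p (g' \<circ> f \<circ> h')"
  then obtain g' h' where gh': "homeomorphic_maps X (nsphere p) g' h'"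
    and d: "d = Brouwer_degree2 p (g' \<circ> f \<circ> h')" by blast
  have c: "continuous_map X (nsphere p) g" "continuous_map (nsphere p) X h"
    "continuous_map X (nsphere p) g'" "continuous_map (nsphere p) X h'"
    using gh gh' by (auto simp: homeomorphic_maps_def)
  let ?a = "g' \<circ> h" and ?b = "g \<circ> h'" and ?F = "g \<circ> f \<circ> h"
  have cont: "continuous_map (nsphere p) (nsphere p) ?a" "continuous_map (nsphere p) (nsphere p) ?b"
    "continuous_map (nsphere p) (nsphere p) ?F"
    using c f by (auto intro: continuous_map_compose)
  have hg: "h (g x) = x" if "x \<in> topspace X" for x
    using gh that by (auto simp: homeomorphic_maps_def)
  have g'h': "g' (h' y) = y" if "y \<in> topspace (nsphere p)" for y
    using gh' that by (auto simp: homeomorphic_maps_def)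
  have ft: "f x \<in> topspace X" if "x \<in> topspace X" for x
    using continuous_map_image_subset_topspace [OF f] that by blast
  have h't: "h' y \<in> topspace X" if "y \<in> topspace (nsphere p)" for y
    using continuous_map_image_subset_topspace [OF c(4)] that by blast
  have "Brouwer_degree2 p (g' \<circ> f \<circ> h') = Brouwer_degree2 p (?a \<circ> (?F \<circ> ?b))"
    by (rule Brouwer_degree2_eq) (simp add: hg ft h't)
  also have "\<dots> = Brouwer_degree2 p ?a * (Brouwer_degree2 p ?F * Brouwer_degree2 p ?b)"
    using cont by (simp add: Brouwer_degree2_compose continuous_map_compose)
  also have "\<dots> = Brouwer_degree2 p ?F * (Brouwer_degree2 p ?a * Brouwer_degree2 p ?b)"
    by simp
  also have "Brouwer_degree2 p ?a * Brouwer_degree2 p ?b = Brouwer_degree2 p (?a \<circ> ?b)"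
    using cont by (simp add: Brouwer_degree2_compose)
  also have "\<dots> = Brouwer_degree2 p id"
    by (rule Brouwer_degree2_eq) (simp add: hg h't g'h')
  finally show "d = Brouwer_degree2 p ?F"
    unfolding d by (simp only: Brouwer_degree2_id mult_1_right)
qed

definition central_projection :: "real^'n \<Rightarrow> real^'n" where
  "central_projection x =
     (THE y. y \<in> simplex_boundary \<and>
        (\<exists>s>0. y = simplex_center + s *\<^sub>R (x - simplex_center)))"

definition linking_number :: "(real^'n \<Rightarrow> real^'n) \<Rightarrow> int" where
  "linking_number f =
     sphere_degree (CARD('n) - 2) (top_of_set simplex_boundary) (central_projection \<circ> f)"

lemma ex1_ray_meets_boundary:
  fixes v :: "real^'n"
  assumes v0: "v \<noteq> 0" and vs: "(\<Sum>i\<in>UNIV. v $ i) = 0"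
  shows "\<exists>!s. s > 0 \<and> simplex_center + s *\<^sub>R v \<in> simplex_boundary"
proof -
  let ?n = "real CARD('n)"
  have n0: "?n > 0" by simp
  define m where "m = Min (range (($) v))"
  have le: "m \<le> v $ i" for i
    unfolding m_def by (intro Min_le) auto
  have "m \<in> range (($) v)"
    unfolding m_def by (intro Min_in) auto
  then obtain k where k: "m = v $ k" by auto
  have m0: "m < 0"
  proof (rule ccontr)
    assume "\<not> m < 0"
    then have "\<And>i. v $ i \<ge> 0" using le by (meson not_less order_trans)
    then have "\<And>i. v $ i = 0" using vs by (simp add: sum_nonneg_eq_0_iff)
    then show False using v0 by (simp add: vec_eq_iff)
  qed
  let ?s = "- 1 / (?n * m)"
  have s0: "?s > 0"
    using m0 n0 by (simp add: divide_neg_neg mult_pos_neg)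
  have "1 / ?n + ?s * (v $ i) \<ge> 0" for i
  proof -
    have "?s * (v $ i) \<ge> ?s * m" using s0 le by (intro mult_left_mono) auto
    moreover have "?s * m = - 1 / ?n" using m0 n0 by (simp add: field_simps)
    ultimately show ?thesis by simp
  qed
  moreover have "1 / ?n + ?s * (v $ k) = 0"
    using m0 n0 k by (simp add: field_simps)
  moreover have "(\<Sum>i\<in>UNIV. 1 / ?n + ?s * (v $ i)) = 1"
    using vs by (simp only: sum.distrib sum_distrib_left [symmetric]) simp
  ultimately have "simplex_center + ?s *\<^sub>R v \<in> simplex_boundary"
    unfolding simplex_boundary_def unit_simplex_def simplex_center_def
    by (auto intro!: exI [of _ k])
  with s0 show ?thesis
  proof (intro ex_ex1I; (elim conjE)?)
    fix s t :: real
    assume "s > 0" "t > 0" and s: "simplex_center + s *\<^sub>R v \<in> simplex_boundary"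
      and t: "simplex_center + t *\<^sub>R v \<in> simplex_boundary"
    obtain i where i: "1 / ?n + s * v $ i = 0" and s': "\<And>i. 1 / ?n + s * v $ i \<ge> 0"
      using s by (auto simp: simplex_boundary_def unit_simplex_def simplex_center_def)
    obtain j where j: "1 / ?n + t * v $ j = 0" and t': "\<And>i. 1 / ?n + t * v $ i \<ge> 0"
      using t by (auto simp: simplex_boundary_def unit_simplex_def simplex_center_def)
    have "s * v $ i < 0" "t * v $ j < 0" using i j n0 by (smt (verit) divide_pos_pos)+
    then have neg: "v $ i < 0" "v $ j < 0"
      using \<open>s > 0\<close> \<open>t > 0\<close> by (auto simp: mult_less_0_iff)
    have "s * v $ i \<le> t * v $ i" "t * v $ j \<le> s * v $ j"
      using i j s' [of j] t' [of i] by linarith+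
    then show "s = t" using neg by (simp add: mult_le_cancel_right)
  qed blast
qed

lemma ex1_central_projection:
  fixes x :: "real^'n"
  assumes "x \<in> unit_simplex" "x \<noteq> simplex_center"
  shows "\<exists>!y. y \<in> simplex_boundary \<and> (\<exists>s>0. y = simplex_center + s *\<^sub>R (x - simplex_center))"
proof -
  have "(\<Sum>i\<in>UNIV. (x - simplex_center) $ i) = 0"
    using assms by (simp add: sum_subtractf simplex_center_def unit_simplex_def)
  with assms(2) have "\<exists>!s. s > 0 \<and> simplex_center + s *\<^sub>R (x - simplex_center) \<in> simplex_boundary"
    by (intro ex1_ray_meets_boundary) auto
  then show ?thesis
    by (elim ex1E) (rule ex1I, blast, blast)
qed

lemma simplex_boundary_homeomorphic_nsphere:
  assumes "CARD('n) \<ge> 2"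
  shows "top_of_set (simplex_boundary :: (real^'n) set) homeomorphic_space nsphere (CARD('n) - 2)"
proof -
  let ?D = "simplex_boundary :: (real^'n) set" and ?c = "simplex_center :: real^'n"
  define U :: "(real^'n) set" where "U = {v. 1 \<bullet> v = 0}"
  have U: "v \<in> U \<longleftrightarrow> (\<Sum>i\<in>UNIV. v $ i) = 0" for v
    by (simp add: U_def inner_vec_def)
  have subU: "subspace U"
    unfolding U_def by (rule subspace_hyperplane)
  have "(1 :: real^'n) \<noteq> 0" by simp
  then have dimU: "dim U = CARD('n) - 1"
    unfolding U_def by (simp add: dim_hyperplane)
  obtain B where B: "B \<subseteq> U" "pairwise orthogonal B" "\<And>x. x \<in> B \<Longrightarrow> norm x = 1"
      "independent B" "card B = dim U" "span B = U"
    using orthonormal_basis_subspace [OF subU] by metis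
  obtain h k where hk: "homeomorphic_maps (nsphere (CARD('n) - 1 - 1)) (top_of_set (sphere 0 1 \<inter> span B)) h k"
    by (rule homeomorphic_maps_nsphere_euclidean_sphere [OF B(4) B(2), of "CARD('n) - 1"])
      (use B dimU assms in auto)
  have sphere: "top_of_set (sphere 0 1 \<inter> U) homeomorphic_space nsphere (CARD('n) - 2)"
    using hk B(6) assms homeomorphic_space_sym
    by (metis diff_diff_left homeomorphic_space_def one_add_one)
  have xc: "x - ?c \<in> U" "x \<noteq> ?c" if "x \<in> ?D" for x
    using that
    by (auto simp: U sum_subtractf simplex_center_def simplex_boundary_def unit_simplex_def)
  define r where "r x = sgn (x - ?c)" for x
  have "compact ?D"
  proof -
    have "?D = {t. \<forall>i. t $ i \<ge> 0} \<inter> {t. (\<Sum>i\<in>UNIV. t $ i) = 1} \<inter> (\<Union>i. {t. t $ i = 0})"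
      by (auto simp: simplex_boundary_def unit_simplex_def)
    moreover have "closed ({t::real^'n. \<forall>i. t $ i \<ge> 0} \<inter> {t. (\<Sum>i\<in>UNIV. t $ i) = 1} \<inter> (\<Union>i. {t. t $ i = 0}))"
      by (intro closed_Int closed_UN ballI closed_Collect_all closed_Collect_eq closed_Collect_le
          continuous_intros finite)
    moreover have "bounded ?D"
    proof (rule boundedI)
      fix t :: "real^'n" assume "t \<in> ?D"
      then show "norm t \<le> 1"
        using norm_le_l1_cart [of t] by (simp add: simplex_boundary_def unit_simplex_def)
    qed
    ultimately show ?thesis by (simp add: compact_eq_bounded_closed)
  qed
  moreover have "continuous_on ?D r"
    unfolding r_def sgn_div_norm using xc(2) by (intro continuous_intros) auto
  moreover have "r ` ?D = sphere 0 1 \<inter> U"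
  proof (intro equalityI subsetI)
    fix v assume "v \<in> r ` ?D"
    then show "v \<in> sphere 0 1 \<inter> U"
      using xc subU by (auto simp: r_def norm_sgn sgn_div_norm subspace_scale)
  next
    fix v assume v: "v \<in> sphere 0 1 \<inter> U"
    then have "v \<noteq> 0" by auto
    with v U obtain s where s: "s > 0" "?c + s *\<^sub>R v \<in> ?D"
      using ex1_ray_meets_boundary by blast
    have "r (?c + s *\<^sub>R v) = v"
      using s(1) v by (simp add: r_def sgn_scaleR) (simp add: sgn_div_norm)
    then show "v \<in> r ` ?D"
      using s(2) by (metis imageI)
  qed
  moreover have "inj_on r ?D"
  proof (rule inj_onI)
    fix x y assume x: "x \<in> ?D" and y: "y \<in> ?D" and "r x = r y"
    define v where "v = r x"
    have "z = ?c + norm (z - ?c) *\<^sub>R r z" if "z \<in> ?D" for z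
      using xc(2) [OF that] by (simp add: r_def sgn_div_norm)
    then have v: "x = ?c + norm (x - ?c) *\<^sub>R v" "y = ?c + norm (y - ?c) *\<^sub>R v"
      using x y \<open>r x = r y\<close> unfolding v_def by metis+
    have "v \<noteq> 0" "(\<Sum>i\<in>UNIV. v $ i) = 0"
      using xc [OF x] subU U [of v]
      by (auto simp: v_def r_def sgn_zero_iff sgn_div_norm subspace_scale)
    from ex1_ray_meets_boundary [OF this] have "norm (x - ?c) = norm (y - ?c)"
      using x y xc(2) v by (metis zero_less_norm_iff right_minus_eq)
    then show "x = y" using v by metis
  qed
  ultimately have "?D homeomorphic (sphere 0 1 \<inter> U)"
    by (rule homeomorphic_compact)
  then have "top_of_set ?D homeomorphic_space top_of_set (sphere 0 1 \<inter> U)"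
    by (force simp: homeomorphic_def homeomorphism_def homeomorphic_space_def homeomorphic_maps_def)
  then show ?thesis
    using sphere homeomorphic_space_trans by blast
qed

end

theory Submission
  imports Defs "HOL-Algebra.Exponent"
begin

text \<open>
  Write \<open>f = c + \<phi>\<close> with \<open>\<phi>\<close> a nowhere vanishing field of vectors with coordinate sum zero, and start
  from \<open>\<phi> x = x - c\<close>, which has degree 1. On a proper face with vertex set \<open>I\<close>, \<open>|I| \<ge> 2\<close>, pick an
  interior point \<open>q\<close> and subtract a large multiple of \<open>q - c\<close> close to \<open>q\<close>: the field then misses the
  direction \<open>q - c\<close>, so its degree drops by 1. If beforehand the field is reflected near \<open>q\<close> in a
  direction \<open>e\<^sub>i - e\<^sub>j\<close> with \<open>i, j \<in> I\<close>, the degree grows by 1 instead. Both modifications commute with the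
  permutations of the coordinates outside \<open>I\<close>, so performing them at corresponding points of all faces
  with \<open>k\<close> vertices is pseudo-equivariant and changes the degree by \<open>\<plusminus> (n choose k)\<close>. As \<open>n\<close> is not a prime
  power, the numbers \<open>n choose k\<close> with \<open>2 \<le> k < n\<close> have greatest common divisor 1, and a suitable
  combination brings the degree down to 0.

  That modifications with disjoint supports contribute additively to the degree is a statement about
  singular chains that are small with respect to an open cover.
\<close>

section \<open>Exchanging two maps on an open cover\<close>

text \<open>Both sides are additive in \<open>c\<close>, so a single simplex suffices. On one inside
  \<open>A\<close> the pair \<open>f\<close>, \<open>g\<close> is \<open>f1\<close>,
  \<open>f2\<close>; on one inside \<open>B\<close> it is \<open>f2\<close>,
  \<open>f1\<close>.\<close>

lemma chain_map_exchange:
  assumes "\<And>s. s \<in> Poly_Mapping.keys c \<Longrightarrow> \<exists>V\<in>{A, B}. s \<in> standard_simplex p \<rightarrow> V"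
    and A: "\<And>x. x \<in> A \<Longrightarrow> f x = f1 x \<and> g x = f2 x"
    and B: "\<And>x. x \<in> B \<Longrightarrow> f x = f2 x \<and> g x = f1 x"
  shows "chain_map p f c + chain_map p g c = chain_map p f1 c + chain_map p f2 c"
proof -
  have "Poly_Mapping.keys c \<subseteq> {s. \<exists>V\<in>{A, B}. s \<in> standard_simplex p \<rightarrow> V}"
    using assms(1) by blast
  then show ?thesis
  proof (induction c rule: frag_induction)
    case (one s)
    then consider "s \<in> standard_simplex p \<rightarrow> A" | "s \<in> standard_simplex p \<rightarrow> B"
      by blast
    then show ?case
    proof cases
      case 1
      then have "simplex_map p f s = simplex_map p f1 s" "simplex_map p g s = simplex_map p f2 s"
        using A by (auto simp: simplex_map_def restrict_def fun_eq_iff Pi_iff)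
      then show ?thesis by simp
    next
      case 2
      then have "simplex_map p f s = simplex_map p f2 s" "simplex_map p g s = simplex_map p f1 s"
        using B by (auto simp: simplex_map_def restrict_def fun_eq_iff Pi_iff)
      then show ?thesis by simp
    qed
  next
    case (diff a b)
    then show ?case
      by (simp add: chain_map_diff algebra_simps)
  qed auto
qed

text \<open>The product of two classes is the set of all sums of representatives. Any
  \<open>z\<close> in the class of \<open>c + d\<close> splits as
  \<open>c + (z - c)\<close>.\<close>

lemma homologous_rel_set_add:
  "homologous_rel_set p X S c \<otimes>\<^bsub>relative_homology_group (int p) X S\<^esub> homologous_rel_set p X S d
     = homologous_rel_set p X S (c + d)"
proof -
  have "z \<in> (\<Union>r\<in>homologous_rel_set p X S c. \<Union>s\<in>homologous_rel_set p X S d. {r + s})"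
    if "homologous_rel p X S (c + d) z" for z
  proof -
    have "homologous_rel p X S (c + d - c) (z - c)"
      using that by (intro homologous_rel_diff) auto
    then show ?thesis
      by (intro UN_I [of c] UN_I [of "z - c"]) auto
  qed
  then show ?thesis
    unfolding mult_relative_homology_group by (auto intro: homologous_rel_add)
qed

text \<open>On cycles made of simplices that are small with respect to the cover \<open>{A, B}\<close> the two sides
  already agree as chains.\<close>

lemma hom_induced_exchange:
  fixes X :: "'a topology" and Y :: "'b topology"
  assumes cont: "continuous_map X Y f" "continuous_map X Y g"
      "continuous_map X Y f1" "continuous_map X Y f2"
    and AB: "openin X A" "openin X B" "topspace X \<subseteq> A \<union> B"
    and A: "\<And>x. x \<in> A \<Longrightarrow> f x = f1 x \<and> g x = f2 x"
    and B: "\<And>x. x \<in> B \<Longrightarrow> f x = f2 x \<and> g x = f1 x"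
    and x: "x \<in> carrier (homology_group (int p) X)"
  shows "hom_induced p X {} Y {} f x \<otimes>\<^bsub>homology_group p Y\<^esub> hom_induced p X {} Y {} g x
       = hom_induced p X {} Y {} f1 x \<otimes>\<^bsub>homology_group p Y\<^esub> hom_induced p X {} Y {} f2 x"
proof -
  obtain c where c: "singular_relcycle p X {} c" "x = homologous_rel_set p X {} c"
    using x by (auto simp: carrier_relative_homology_group)
  obtain d where d: "singular_relcycle p X {} d" "homologous_rel p X {} c d"
    and small: "\<And>s. s \<in> Poly_Mapping.keys d \<Longrightarrow> \<exists>V\<in>{A, B}. s \<in> standard_simplex p \<rightarrow> V"
    using small_homologous_rel_relcycle_exists [of "{A, B}" X p "{}" c] AB c(1) by auto
  have xd: "x = homologous_rel_set p X {} d"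
    using c d by (simp add: homologous_rel_set_eq)
  have *: "hom_induced p X {} Y {} h x = homologous_rel_set p Y {} (chain_map p h d)"
    if "continuous_map X Y h" for h
    unfolding xd by (rule hom_induced_chain_map [OF that _ d(1)]) auto
  show ?thesis
    by (simp add: * cont homologous_rel_set_add chain_map_exchange [OF small A B])
qed

text \<open>A generator of the reduced homology of the sphere has infinite order, so the exchange
  equation for its images becomes an equation between exponents, which are the degrees.\<close>

lemma Brouwer_degree2_exchange:
  assumes cont: "continuous_map (nsphere p) (nsphere p) f" "continuous_map (nsphere p) (nsphere p) g"
      "continuous_map (nsphere p) (nsphere p) f1" "continuous_map (nsphere p) (nsphere p) f2"
    and AB: "openin (nsphere p) A" "openin (nsphere p) B" "topspace (nsphere p) \<subseteq> A \<union> B"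
    and A: "\<And>x. x \<in> A \<Longrightarrow> f x = f1 x \<and> g x = f2 x"
    and B: "\<And>x. x \<in> B \<Longrightarrow> f x = f2 x \<and> g x = f1 x"
  shows "Brouwer_degree2 p f + Brouwer_degree2 p g = Brouwer_degree2 p f1 + Brouwer_degree2 p f2"
proof -
  let ?G = "reduced_homology_group (int p) (nsphere p)"
  interpret group ?G by simp
  obtain a where a: "a \<in> carrier ?G" and aeq: "subgroup_generated ?G {a} = ?G"
    using cyclic_reduced_homology_group_nsphere [of p p] by (auto simp: cyclic_group_def)
  have ord: "ord a = 0"
    by (simp add: a aeq iso_finite [OF reduced_homology_group_nsphere(1)]
        flip: infinite_cyclic_subgroup_order)
  \<comment> \<open>Reduced homology sits inside ordinary homology with the same operation, so the
    exchange lemma applies to the generator.\<close>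
  have mult: "(\<otimes>\<^bsub>?G\<^esub>) = (\<otimes>\<^bsub>homology_group (int p) (nsphere p)\<^esub>)"
    by (simp add: reduced_homology_group_def subgroup_generated_def)
  have "a \<in> carrier (homology_group (int p) (nsphere p))"
    using a carrier_reduced_homology_group_subset by blast
  from hom_induced_exchange [OF cont AB A B this]
  have "a [^]\<^bsub>?G\<^esub> Brouwer_degree2 p f \<otimes>\<^bsub>?G\<^esub> a [^]\<^bsub>?G\<^esub> Brouwer_degree2 p g
      = a [^]\<^bsub>?G\<^esub> Brouwer_degree2 p f1 \<otimes>\<^bsub>?G\<^esub> a [^]\<^bsub>?G\<^esub> Brouwer_degree2 p f2"
    unfolding Brouwer_degree2 [OF a] mult .
  then have "a [^]\<^bsub>?G\<^esub> (Brouwer_degree2 p f + Brouwer_degree2 p g)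
      = a [^]\<^bsub>?G\<^esub> (Brouwer_degree2 p f1 + Brouwer_degree2 p f2)"
    using a by (simp add: int_pow_mult)
  then show ?thesis
    using a ord by (simp add: int_pow_eq)
qed

section \<open>The degree of a nowhere vanishing field on the boundary\<close>

definition sum_zero :: "(real^'n) set" where
  "sum_zero = {v. (\<Sum>i\<in>UNIV. v $ i) = 0}"

definition least_coord :: "real^'n \<Rightarrow> real" where
  "least_coord v = Min (range (($) v))"

text \<open>For nonzero \<open>v\<close> in \<open>sum_zero\<close>, the scale is the one at which
  the least coordinate reaches 0, that is, where the ray from the center leaves the simplex. This
  closed form of the central projection makes its continuity visible.\<close>

definition ray_point :: "real^'n \<Rightarrow> real^'n" where
  "ray_point v = simplex_center + (- 1 / (real CARD('n) * least_coord v)) *\<^sub>R v"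

lemma least_coord_le: "least_coord v \<le> v $ i"
  unfolding least_coord_def by (intro Min_le) auto

lemma least_coord_in: "\<exists>i. least_coord v = v $ i"
proof -
  have "least_coord v \<in> range (($) v)"
    unfolding least_coord_def by (intro Min_in) auto
  then show ?thesis by auto
qed

lemma continuous_on_Min_image:
  fixes f :: "'i \<Rightarrow> 'a::topological_space \<Rightarrow> 'b::linorder_topology"
  assumes "finite I" "I \<noteq> {}" "\<And>i. i \<in> I \<Longrightarrow> continuous_on S (f i)"
  shows "continuous_on S (\<lambda>x. Min ((\<lambda>i. f i x) ` I))"
  using assms
proof (induction I rule: finite_ne_induct)
  case (insert i I)
  then have "continuous_on S (\<lambda>x. min (f i x) (Min ((\<lambda>i. f i x) ` I)))"
    by (intro continuous_on_min) auto
  with insert show ?case by simp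
qed simp

lemma continuous_on_least_coord: "continuous_on S least_coord"
  unfolding least_coord_def by (intro continuous_on_Min_image continuous_intros) auto

lemma least_coord_neg:
  assumes "v \<in> sum_zero" "v \<noteq> 0"
  shows "least_coord v < 0"
proof (rule ccontr)
  assume "\<not> least_coord v < 0"
  then have "\<And>i. v $ i \<ge> 0" using least_coord_le by (meson not_less order_trans)
  then have "\<And>i. v $ i = 0" using assms(1) by (simp add: sum_zero_def sum_nonneg_eq_0_iff)
  then show False using assms(2) by (simp add: vec_eq_iff)
qed

lemma ray_scale_pos:
  fixes v :: "real^'n"
  assumes "v \<in> sum_zero" "v \<noteq> 0"
  shows "- 1 / (real CARD('n) * least_coord v) > 0"
  using least_coord_neg [OF assms] by (simp add: divide_neg_neg mult_pos_neg)

lemma ray_point_in_boundary: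
  fixes v :: "real^'n"
  assumes v: "v \<in> sum_zero" "v \<noteq> 0"
  shows "ray_point v \<in> simplex_boundary"
proof -
  let ?n = "real CARD('n)" let ?s = "- 1 / (?n * least_coord v)"
  have n0: "?n > 0" by simp
  note m0 = least_coord_neg [OF v] and s0 = ray_scale_pos [OF v]
  have "1 / ?n + ?s * (v $ i) \<ge> 0" for i
  proof -
    have "?s * (v $ i) \<ge> ?s * least_coord v"
      using s0 by (intro mult_left_mono least_coord_le) auto
    moreover have "?s * least_coord v = - 1 / ?n" using m0 n0 by (simp add: field_simps)
    ultimately show ?thesis by simp
  qed
  moreover obtain k where "least_coord v = v $ k" using least_coord_in by blast
  then have "1 / ?n + ?s * (v $ k) = 0"
    using m0 n0 by (simp add: field_simps)
  moreover have "(\<Sum>i\<in>UNIV. 1 / ?n + ?s * (v $ i)) = 1"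
    using v(1) unfolding sum_zero_def
    by (simp only: sum.distrib sum_distrib_left [symmetric]) simp
  ultimately show ?thesis
    unfolding ray_point_def simplex_boundary_def unit_simplex_def simplex_center_def
    by (auto intro!: exI [of _ k])
qed

lemma central_projection_eqI:
  fixes v :: "real^'n"
  assumes v: "v \<in> sum_zero" "v \<noteq> 0"
    and y: "y \<in> simplex_boundary" "s > 0" "y = simplex_center + s *\<^sub>R v"
  shows "central_projection (simplex_center + v) = y"
  unfolding central_projection_def
proof (rule the_equality)
  show "y \<in> simplex_boundary \<and>
      (\<exists>s>0. y = simplex_center + s *\<^sub>R (simplex_center + v - simplex_center))"
    using y by auto
next
  have ex1: "\<exists>!s. s > 0 \<and> simplex_center + s *\<^sub>R v \<in> simplex_boundary"
    using v by (intro ex1_ray_meets_boundary) (auto simp: sum_zero_def)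
  fix z assume "z \<in> simplex_boundary \<and>
      (\<exists>s>0. z = simplex_center + s *\<^sub>R (simplex_center + v - simplex_center))"
  then show "z = y" using ex1 y by auto
qed

lemma central_projection_eq:
  fixes v :: "real^'n"
  assumes "v \<in> sum_zero" "v \<noteq> 0"
  shows "central_projection (simplex_center + v) = ray_point v"
  using assms ray_point_in_boundary [OF assms] ray_scale_pos [OF assms]
  by (rule central_projection_eqI) (simp add: ray_point_def)

lemma central_projection_boundary:
  assumes "x \<in> simplex_boundary"
  shows "x - simplex_center \<in> sum_zero" "x \<noteq> simplex_center"
    "central_projection x = x"
proof -
  show 1: "x - simplex_center \<in> sum_zero" "x \<noteq> simplex_center"
    using assms
    by (auto simp: sum_zero_def sum_subtractf simplex_center_def simplex_boundary_def
        unit_simplex_def)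
  show "central_projection x = x"
    using central_projection_eqI [OF 1(1) _ assms, of 1] 1(2) by simp
qed

lemma continuous_on_ray_point: "continuous_on (sum_zero - {0}) ray_point"
  unfolding ray_point_def
  by (intro continuous_intros continuous_on_subset [OF continuous_on_least_coord])
    (use least_coord_neg in fastforce)+

definition nonzero_field :: "(real^'n \<Rightarrow> real^'n) \<Rightarrow> bool" where
  "nonzero_field \<phi> \<longleftrightarrow> continuous_on simplex_boundary \<phi> \<and> \<phi> ` simplex_boundary \<subseteq> sum_zero - {0}"

text \<open>The point \<open>simplex_center + \<phi> x\<close> may lie outside the simplex. The
  central projection depends only on its ray from the center, so fields can be handled without
  regard to their size and shrunk at the very end.\<close>

definition field_degree :: "(real^'n \<Rightarrow> real^'n) \<Rightarrow> int" where
  "field_degree \<phi> = linking_number (\<lambda>x. simplex_center + \<phi> x)"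

lemma nonzero_fieldD:
  assumes "nonzero_field \<phi>" "x \<in> simplex_boundary"
  shows "\<phi> x \<in> sum_zero" "\<phi> x \<noteq> 0"
  using assms by (auto simp: nonzero_field_def)

lemma nonzero_field_continuous_map:
  assumes "nonzero_field \<phi>"
  shows "continuous_map (top_of_set simplex_boundary) (top_of_set simplex_boundary) (ray_point \<circ> \<phi>)"
proof -
  have "continuous_on simplex_boundary (ray_point \<circ> \<phi>)"
    using assms unfolding nonzero_field_def
    by (intro continuous_on_compose continuous_on_subset [OF continuous_on_ray_point]) auto
  then show ?thesis
    using assms ray_point_in_boundary unfolding nonzero_field_def by fastforce
qed

lemma transported_field_continuous_map:
  assumes "nonzero_field \<phi>" "homeomorphic_maps (top_of_set simplex_boundary) S g h"
  shows "continuous_map S S (g \<circ> (ray_point \<circ> \<phi>) \<circ> h)"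
  using assms nonzero_field_continuous_map
  by (metis continuous_map_compose homeomorphic_maps_def)

lemma field_degree_eq:
  fixes \<phi> :: "real^'n \<Rightarrow> real^'n"
  assumes \<phi>: "nonzero_field \<phi>"
    and gh: "homeomorphic_maps (top_of_set (simplex_boundary :: (real^'n) set))
      (nsphere (CARD('n) - 2)) g h"
  shows "field_degree \<phi> = Brouwer_degree2 (CARD('n) - 2) (g \<circ> (ray_point \<circ> \<phi>) \<circ> h)"
proof -
  let ?X = "top_of_set (simplex_boundary :: (real^'n) set)"
  let ?f = "central_projection \<circ> (\<lambda>x. simplex_center + \<phi> x)"
  have eq: "?f x = (ray_point \<circ> \<phi>) x" if "x \<in> simplex_boundary" for x
    using central_projection_eq [OF nonzero_fieldD [OF \<phi> that]] by simp
  have "continuous_map ?X ?X ?f"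
    using nonzero_field_continuous_map [OF \<phi>] by (rule continuous_map_eq) (use eq in simp)
  then have "field_degree \<phi> = Brouwer_degree2 (CARD('n) - 2) (g \<circ> ?f \<circ> h)"
    unfolding field_degree_def linking_number_def using gh by (rule sphere_degree_eq)
  also have "\<dots> = Brouwer_degree2 (CARD('n) - 2) (g \<circ> (ray_point \<circ> \<phi>) \<circ> h)"
  proof (rule Brouwer_degree2_eq)
    fix y assume "y \<in> topspace (nsphere (CARD('n) - 2))"
    then have "h y \<in> simplex_boundary"
      using gh by (auto simp: homeomorphic_maps_def dest!: continuous_map_image_subset_topspace)
    then show "(g \<circ> ?f \<circ> h) y = (g \<circ> (ray_point \<circ> \<phi>) \<circ> h) y"
      using eq by simp
  qed
  finally show ?thesis .
qed

lemma boundary_sphere_maps: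
  assumes "CARD('n) \<ge> 2"
  obtains g h where "homeomorphic_maps (top_of_set (simplex_boundary :: (real^'n) set))
      (nsphere (CARD('n) - 2)) g h"
  using simplex_boundary_homeomorphic_nsphere [OF assms] by (auto simp: homeomorphic_space_def)

lemma field_degree_homotopy:
  fixes \<phi> \<psi> :: "real^'n \<Rightarrow> real^'n"
  assumes n: "CARD('n) \<ge> 2" and \<phi>: "nonzero_field \<phi>" and \<psi>: "nonzero_field \<psi>"
    and nz: "\<And>x t. x \<in> simplex_boundary \<Longrightarrow> 0 \<le> t \<Longrightarrow> t \<le> 1 \<Longrightarrow> (1 - t) *\<^sub>R \<phi> x + t *\<^sub>R \<psi> x \<noteq> 0"
  shows "field_degree \<phi> = field_degree \<psi>"
proof -
  let ?D = "simplex_boundary :: (real^'n) set"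
  let ?X = "top_of_set ?D" and ?S = "nsphere (CARD('n) - 2)"
  obtain g h where gh: "homeomorphic_maps ?X ?S g h"
    using boundary_sphere_maps [OF n] by blast
  then have c: "continuous_map ?X ?S g" "continuous_map ?S ?X h"
    by (auto simp: homeomorphic_maps_def)
  have "homotopic_with_canon (\<lambda>x. True) ?D (sum_zero - {0}) \<phi> \<psi>"
  proof (rule homotopic_with_linear)
    fix x assume x: "x \<in> ?D"
    then have "\<phi> x \<in> sum_zero" "\<psi> x \<in> sum_zero"
      using \<phi> \<psi> by (auto simp: nonzero_field_def)
    then have "(1 - t) *\<^sub>R \<phi> x + t *\<^sub>R \<psi> x \<in> sum_zero" for t
      by (simp add: sum_zero_def sum.distrib flip: sum_distrib_left)
    then show "closed_segment (\<phi> x) (\<psi> x) \<subseteq> sum_zero - {0}"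
      using nz [OF x] by (auto simp: closed_segment_def)
  qed (use \<phi> \<psi> in \<open>auto simp: nonzero_field_def\<close>)
  moreover have "continuous_map (top_of_set (sum_zero - {0})) ?X ray_point"
    by (auto simp: continuous_on_ray_point intro: ray_point_in_boundary)
  ultimately have "homotopic_with (\<lambda>x. True) ?X ?X (ray_point \<circ> \<phi>) (ray_point \<circ> \<psi>)"
    by (rule homotopic_with_compose_continuous_map_left) simp
  then have "homotopic_with (\<lambda>x. True) ?S ?S (g \<circ> (ray_point \<circ> \<phi>) \<circ> h) (g \<circ> (ray_point \<circ> \<psi>) \<circ> h)"
    by (intro homotopic_with_compose_continuous_map_right [OF _ c(2)]
        homotopic_with_compose_continuous_map_left [OF _ c(1)]) simp_all
  then show ?thesis
    using field_degree_eq [OF \<phi> gh] field_degree_eq [OF \<psi> gh] Brouwer_degree2_homotopic by simp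
qed

text \<open>Fields with the same \<open>ray_point\<close> are positive multiples of each other, so
  the projected map misses \<open>ray_point w\<close>. A self-map of a sphere that is not surjective
  has degree 0.\<close>

lemma field_degree_missed_direction:
  fixes \<phi> :: "real^'n \<Rightarrow> real^'n"
  assumes n: "CARD('n) \<ge> 2" and \<phi>: "nonzero_field \<phi>"
    and w: "w \<in> sum_zero" "w \<noteq> 0"
    and miss: "\<And>x r. x \<in> simplex_boundary \<Longrightarrow> r > 0 \<Longrightarrow> \<phi> x \<noteq> r *\<^sub>R w"
  shows "field_degree \<phi> = 0"
proof -
  let ?D = "simplex_boundary :: (real^'n) set"
  let ?X = "top_of_set ?D" and ?S = "nsphere (CARD('n) - 2)"
  obtain g h where gh: "homeomorphic_maps ?X ?S g h"
    using boundary_sphere_maps [OF n] by blast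
  then have c: "continuous_map ?X ?S g" "continuous_map ?S ?X h"
    and hg: "\<And>x. x \<in> ?D \<Longrightarrow> h (g x) = x"
    by (auto simp: homeomorphic_maps_def)
  let ?F = "g \<circ> (ray_point \<circ> \<phi>) \<circ> h"
  have F: "continuous_map ?S ?S ?F"
    by (rule transported_field_continuous_map [OF \<phi> gh])
  have w': "ray_point w \<in> ?D" using w by (rule ray_point_in_boundary)
  then have "g (ray_point w) \<in> topspace ?S"
    using continuous_map_image_subset_topspace [OF c(1)] by auto
  moreover have "g (ray_point w) \<notin> ?F ` topspace ?S"
  proof
    assume "g (ray_point w) \<in> ?F ` topspace ?S"
    then obtain y where y: "y \<in> topspace ?S" "g (ray_point w) = g (ray_point (\<phi> (h y)))"
      by auto
    then have hy: "h y \<in> ?D"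
      using continuous_map_image_subset_topspace [OF c(2)] by auto
    then have v: "\<phi> (h y) \<in> sum_zero" "\<phi> (h y) \<noteq> 0"
      using \<phi> by (auto simp: nonzero_field_def)
    have "ray_point w = ray_point (\<phi> (h y))"
      using y(2) hg [OF w'] hg [OF ray_point_in_boundary [OF v]] by metis
    then obtain a b where "a > 0" "b > 0" "a *\<^sub>R w = b *\<^sub>R \<phi> (h y)"
      using ray_scale_pos [OF w] ray_scale_pos [OF v] unfolding ray_point_def add_left_cancel
      by blast
    then have "\<phi> (h y) = (a / b) *\<^sub>R w"
      by (simp add: divide_inverse_commute)
        (metis left_inverse order_less_irrefl scaleR_left_imp_eq scaleR_one scaleR_scaleR)
    then show False
      using miss [OF hy, of "a / b"] \<open>a > 0\<close> \<open>b > 0\<close> by simp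
  qed
  ultimately have "?F ` topspace ?S \<noteq> topspace ?S" by blast
  then show ?thesis
    using field_degree_eq [OF \<phi> gh] Brouwer_degree2_nonsurjective [OF F] by simp
qed

lemma nonzero_field_identity: "nonzero_field (\<lambda>x. x - simplex_center)"
  using central_projection_boundary
  by (fastforce simp: nonzero_field_def intro: continuous_intros)

lemma field_degree_identity:
  assumes "CARD('n) \<ge> 2"
  shows "field_degree (\<lambda>x::real^'n. x - simplex_center) = 1"
proof -
  let ?X = "top_of_set (simplex_boundary :: (real^'n) set)" and ?S = "nsphere (CARD('n) - 2)"
  obtain g h where gh: "homeomorphic_maps ?X ?S g h"
    using boundary_sphere_maps [OF assms] by blast
  have "field_degree (\<lambda>x::real^'n. x - simplex_center)
      = Brouwer_degree2 (CARD('n) - 2) (g \<circ> (ray_point \<circ> (\<lambda>x. x - simplex_center)) \<circ> h)"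
    by (rule field_degree_eq [OF nonzero_field_identity gh])
  also have "\<dots> = Brouwer_degree2 (CARD('n) - 2) id"
  proof (rule Brouwer_degree2_eq)
    fix y assume y: "y \<in> topspace ?S"
    then have hy: "h y \<in> simplex_boundary"
      using gh by (auto simp: homeomorphic_maps_def dest!: continuous_map_image_subset_topspace)
    have "ray_point (h y - simplex_center) = h y"
      using central_projection_eq [of "h y - simplex_center"] central_projection_boundary [OF hy]
      by simp
    then show "(g \<circ> (ray_point \<circ> (\<lambda>x. x - simplex_center)) \<circ> h) y = id y"
      using gh y by (simp add: homeomorphic_maps_def)
  qed
  finally show ?thesis by simp
qed

text \<open>This is the tool behind the degree of a reflection, of a reflected bump and of a sum of
  bumps. It is transported from the sphere, where the cover is pulled back along
  \<open>h\<close>.\<close>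

lemma field_degree_exchange:
  fixes f g f1 f2 :: "real^'n \<Rightarrow> real^'n"
  assumes n: "CARD('n) \<ge> 2"
    and nz: "nonzero_field f" "nonzero_field g" "nonzero_field f1" "nonzero_field f2"
    and AB: "open A" "open B" "simplex_boundary \<subseteq> A \<union> B"
    and A: "\<And>x. x \<in> simplex_boundary \<inter> A \<Longrightarrow> f x = f1 x \<and> g x = f2 x"
    and B: "\<And>x. x \<in> simplex_boundary \<inter> B \<Longrightarrow> f x = f2 x \<and> g x = f1 x"
  shows "field_degree f + field_degree g = field_degree f1 + field_degree f2"
proof -
  let ?D = "simplex_boundary :: (real^'n) set"
  let ?X = "top_of_set ?D" and ?S = "nsphere (CARD('n) - 2)"
  obtain k h where kh: "homeomorphic_maps ?X ?S k h"
    using boundary_sphere_maps [OF n] by blast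
  then have c: "continuous_map ?X ?S k" "continuous_map ?S ?X h"
    by (auto simp: homeomorphic_maps_def)
  have hD: "h y \<in> ?D" if "y \<in> topspace ?S" for y
    using continuous_map_image_subset_topspace [OF c(2)] that by auto
  have op: "openin ?S {y \<in> topspace ?S. h y \<in> ?D \<inter> C}" if "open C" for C
    using that by (intro openin_continuous_map_preimage [OF c(2)]) (simp add: openin_open_Int)
  show ?thesis
    unfolding nz [THEN field_degree_eq, OF kh]
  proof (rule Brouwer_degree2_exchange)
    show "openin ?S {y \<in> topspace ?S. h y \<in> ?D \<inter> A}" "openin ?S {y \<in> topspace ?S. h y \<in> ?D \<inter> B}"
      using AB op by blast+
    show "topspace ?S \<subseteq> {y \<in> topspace ?S. h y \<in> ?D \<inter> A} \<union> {y \<in> topspace ?S. h y \<in> ?D \<inter> B}"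
      using AB(3) hD by blast
  qed (use A B nz [THEN transported_field_continuous_map, OF kh] in auto)
qed

lemma sum_zero_linear_combination [simp]:
  "0 \<in> sum_zero"
  "u \<in> sum_zero \<Longrightarrow> v \<in> sum_zero \<Longrightarrow> u + v \<in> sum_zero"
  "u \<in> sum_zero \<Longrightarrow> v \<in> sum_zero \<Longrightarrow> u - v \<in> sum_zero"
  "u \<in> sum_zero \<Longrightarrow> r *\<^sub>R u \<in> sum_zero"
  by (auto simp: sum_zero_def sum.distrib sum_subtractf simp flip: sum_distrib_left)

lemma nonzero_fieldI:
  assumes "continuous_on simplex_boundary \<phi>"
    and "\<And>x. x \<in> simplex_boundary \<Longrightarrow> \<phi> x \<in> sum_zero"
    and "\<And>x. x \<in> simplex_boundary \<Longrightarrow> \<phi> x \<noteq> 0"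
  shows "nonzero_field \<phi>"
  using assms by (auto simp: nonzero_field_def)

lemma norm_boundary_minus_center_ge:
  fixes x :: "real^'n"
  assumes "x \<in> simplex_boundary"
  shows "norm (x - simplex_center) \<ge> 1 / real CARD('n)"
proof -
  obtain i where "x $ i = 0" using assms by (auto simp: simplex_boundary_def)
  then show ?thesis
    using component_le_norm_cart [of "x - simplex_center" i] by (simp add: simplex_center_def)
qed

lemma boundary_ray_unique:
  assumes x: "x \<in> simplex_boundary" and q: "q \<in> simplex_boundary"
    and "0 \<le> r" and eq: "x - simplex_center = r *\<^sub>R (q - simplex_center)"
  shows "x = q" "r = 1"
proof -
  note q' = central_projection_boundary [OF q]
  have "r \<noteq> 0" using eq central_projection_boundary(2) [OF x] by auto
  then have r: "r > 0" using \<open>0 \<le> r\<close> by simp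
  have "x = simplex_center + r *\<^sub>R (q - simplex_center)"
    using eq by (metis add.commute diff_add_cancel)
  from central_projection_eqI [OF q'(1) _ x r this] q'(2,3) show "x = q" by simp
  then have "(1 - r) *\<^sub>R (q - simplex_center) = 0"
    using eq by (simp add: scaleR_left_diff_distrib)
  then show "r = 1" using q'(2) by simp
qed

section \<open>Reflections in an oblique direction\<close>

text \<open>Every vector splits into a part in the kernel of \<open>l\<close> and a multiple of
  \<open>e\<close>. No orthogonality is demanded, so that later the kernel can contain
  \<open>q - c\<close> while \<open>e\<close> is a multiple of a difference of two unit
  vectors.\<close>

locale oblique_axis =
  fixes l :: "real^'n \<Rightarrow> real" and e :: "real^'n"
  assumes n2: "CARD('n) \<ge> 2" and lin: "linear l" and e: "e \<in> sum_zero" and le: "l e = 1"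
begin

lemma e_nonzero: "e \<noteq> 0"
  using le linear_0 [OF lin] by auto

lemma continuous_on_l: "continuous_on S (\<lambda>x. l (x - simplex_center))"
  by (rule continuous_on_compose2 [OF linear_continuous_on
        [OF lin [unfolded linear_conv_bounded_linear], of UNIV]])
    (auto intro!: continuous_intros)

text \<open>The profiles \<open>b\<close> and \<open>- b\<close> give the identity field and the
  reflection; profiles of constant sign are foldings onto a half space.\<close>

definition profile_map :: "(real \<Rightarrow> real) \<Rightarrow> real^'n \<Rightarrow> real^'n" where
  "profile_map \<kappa> x = (let y = x - simplex_center in y - l y *\<^sub>R e + \<kappa> (l y) *\<^sub>R e)"

lemma l_profile_map: "l (profile_map \<kappa> x) = \<kappa> (l (x - simplex_center))"
  using lin le by (simp add: profile_map_def Let_def linear_add linear_diff linear_scale)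

lemma profile_map_id: "profile_map (\<lambda>b. b) = (\<lambda>x. x - simplex_center)"
  by (simp add: profile_map_def Let_def fun_eq_iff)

text \<open>A zero forces \<open>x - c\<close> to be a multiple \<open>b\<close> of \<open>e\<close>
  with \<open>\<kappa> b = 0\<close>. Boundary points have distance at least \<open>1/n\<close> from
  the center, so zeros of the profile close to 0 do no harm.\<close>

lemma profile_map_zeroD:
  assumes x: "x \<in> simplex_boundary"
    and "\<kappa> (l (x - simplex_center)) = 0 \<Longrightarrow> \<bar>l (x - simplex_center)\<bar> * norm e < 1 / real CARD('n)"
  shows "profile_map \<kappa> x \<noteq> 0"
proof
  assume 0: "profile_map \<kappa> x = 0"
  then have k0: "\<kappa> (l (x - simplex_center)) = 0"
    using l_profile_map [of \<kappa> x] linear_0 [OF lin] by simp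
  then have "x - simplex_center = l (x - simplex_center) *\<^sub>R e"
    using 0 by (simp add: profile_map_def Let_def)
  then have "norm (x - simplex_center) < 1 / real CARD('n)"
    using assms(2) [OF k0] by (metis norm_scaleR)
  then show False using norm_boundary_minus_center_ge [OF x] by simp
qed

lemma nonzero_field_profile:
  assumes "continuous_on UNIV \<kappa>" "\<And>b. \<kappa> b = 0 \<Longrightarrow> \<bar>b\<bar> * norm e < 1 / real CARD('n)"
  shows "nonzero_field (profile_map \<kappa>)"
proof (rule nonzero_fieldI)
  show "continuous_on simplex_boundary (profile_map \<kappa>)"
    unfolding profile_map_def Let_def
    by (intro continuous_intros continuous_on_l continuous_on_compose2 [OF assms(1) continuous_on_l]) auto
  show "profile_map \<kappa> x \<in> sum_zero" "profile_map \<kappa> x \<noteq> 0" if "x \<in> simplex_boundary" for x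
    using that assms(2) e central_projection_boundary(1) [OF that] profile_map_zeroD
    by (auto simp: profile_map_def Let_def)
qed

lemma profile_homotopy:
  assumes "continuous_on UNIV \<kappa>" "continuous_on UNIV \<kappa>'"
    and zero: "\<And>t b. 0 \<le> t \<Longrightarrow> t \<le> 1 \<Longrightarrow> (1 - t) * \<kappa> b + t * \<kappa>' b = 0 \<Longrightarrow> \<bar>b\<bar> * norm e < 1 / real CARD('n)"
  shows "field_degree (profile_map \<kappa>) = field_degree (profile_map \<kappa>')"
proof (rule field_degree_homotopy [OF n2])
  show "nonzero_field (profile_map \<kappa>)"
    using assms(1) zero [of 0] by (intro nonzero_field_profile) auto
  show "nonzero_field (profile_map \<kappa>')"
    using assms(2) zero [of 1] by (intro nonzero_field_profile) auto
  fix x :: "real^'n" and t :: real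
  assume x: "x \<in> simplex_boundary" and t: "0 \<le> t" "t \<le> 1"
  have "(1 - t) *\<^sub>R profile_map \<kappa> x + t *\<^sub>R profile_map \<kappa>' x = profile_map (\<lambda>b. (1 - t) * \<kappa> b + t * \<kappa>' b) x"
    by (simp add: profile_map_def Let_def algebra_simps)
  also have "\<dots> \<noteq> 0"
    using x zero [OF t] by (rule profile_map_zeroD)
  finally show "(1 - t) *\<^sub>R profile_map \<kappa> x + t *\<^sub>R profile_map \<kappa>' x \<noteq> 0" .
qed

text \<open>The value of \<open>l\<close> on the field never has the sign of \<open>r\<close>, so
  the direction \<open>r *\<^sub>R e\<close> is missed.\<close>

lemma profile_one_sided:
  assumes nz: "nonzero_field (profile_map \<kappa>)" and r: "r \<noteq> 0" and sign: "\<And>b. \<kappa> b * r \<le> 0"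
  shows "field_degree (profile_map \<kappa>) = 0"
proof (rule field_degree_missed_direction [OF n2 nz])
  show "r *\<^sub>R e \<in> sum_zero" "r *\<^sub>R e \<noteq> 0" using e e_nonzero r by auto
  fix x :: "real^'n" and a :: real
  assume "0 < a"
  show "profile_map \<kappa> x \<noteq> a *\<^sub>R (r *\<^sub>R e)"
  proof
    assume "profile_map \<kappa> x = a *\<^sub>R (r *\<^sub>R e)"
    then have "\<kappa> (l (x - simplex_center)) = a * r"
      using l_profile_map [of \<kappa> x] lin le by (simp add: linear_scale)
    then have "a * r * r \<le> 0" using sign by metis
    moreover have "a * r\<^sup>2 > 0" using \<open>0 < a\<close> r by simp
    ultimately show False by (simp add: power2_eq_square)
  qed
qed

text \<open>Collapsing a slab around the kernel of \<open>l\<close> makes the identity, the reflection and the two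
  foldings onto a half space agree there; exchanging halves gives \<open>1 + deg = 0 + 0\<close>.\<close>

lemma field_degree_reflection:
  "field_degree (\<lambda>x. (x - simplex_center) - (2 * l (x - simplex_center)) *\<^sub>R e) = - 1"
proof -
  \<comment> \<open>Half of the bound on \<open>\<bar>b\<bar>\<close> below which zeros of a profile
    are harmless.\<close>
  define d where "d = 1 / (2 * real CARD('n) * norm e)"
  have d: "d > 0" "d * norm e < 1 / real CARD('n)"
    using e_nonzero by (auto simp: d_def field_simps)
  \<comment> \<open>This is 0 on the slab from \<open>- d\<close> to \<open>d\<close> and the
    identity shifted towards 0 by \<open>d\<close> on either side of it.\<close>
  define \<psi> where "\<psi> b = max 0 (b - d) + min 0 (b + d)" for b :: real
  have \<psi>: "\<psi> b \<ge> 0" if "b > - d" for b using that d by (simp add: \<psi>_def)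
  have \<psi>': "\<psi> b \<le> 0" if "b < d" for b using that d by (simp add: \<psi>_def)
  have small: "\<bar>b\<bar> * norm e < 1 / real CARD('n)" if "\<bar>b\<bar> \<le> d" for b
    using that d mult_right_mono [OF that, of "norm e"] by simp
  have zero: "\<bar>b\<bar> \<le> d" if "\<psi> b = 0" for b
    using that d by (simp add: \<psi>_def max_def min_def split: if_splits)
  \<comment> \<open>Outside the slab \<open>b\<close> and \<open>\<psi> b\<close> have the same
    strict sign, so no convex combination of them vanishes.\<close>
  have zero': "\<bar>b\<bar> \<le> d" if "0 \<le> t" "t \<le> 1" "(1 - t) * b + t * \<psi> b = 0" for b t
  proof (rule ccontr)
    assume "\<not> \<bar>b\<bar> \<le> d"
    then consider "b > d" "\<psi> b > 0" | "b < - d" "\<psi> b < 0"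
      using d by (fastforce simp: \<psi>_def)
    then show False
    proof cases
      case 1
      then have "(1 - t) * b \<ge> 0" "t * \<psi> b \<ge> 0" using that d by auto
      then have "(1 - t) * b = 0" "t * \<psi> b = 0" using that by linarith+
      then show False using 1 d by auto
    next
      case 2
      then have "(1 - t) * b \<le> 0" "t * \<psi> b \<le> 0"
        using that d by (auto simp: mult_le_0_iff)
      then have "(1 - t) * b = 0" "t * \<psi> b = 0" using that by linarith+
      then show False using 2 d by auto
    qed
  qed
  have cont: "continuous_on UNIV \<psi>"
    unfolding \<psi>_def by (intro continuous_intros)
  let ?P = "\<lambda>\<kappa>. field_degree (profile_map \<kappa>)"
  have nz: "nonzero_field (profile_map \<psi>)" "nonzero_field (profile_map (\<lambda>b. - \<psi> b))"
    "nonzero_field (profile_map (\<lambda>b. \<bar>\<psi> b\<bar>))" "nonzero_field (profile_map (\<lambda>b. - \<bar>\<psi> b\<bar>))"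
    by (intro nonzero_field_profile continuous_intros cont; use zero small in auto)+
  have "?P \<psi> + ?P (\<lambda>b. - \<psi> b) = ?P (\<lambda>b. \<bar>\<psi> b\<bar>) + ?P (\<lambda>b. - \<bar>\<psi> b\<bar>)"
  proof (rule field_degree_exchange [OF n2 nz])
    \<comment> \<open>The two half spaces overlap only where \<open>\<psi>\<close> vanishes. On the
      first \<open>\<bar>\<psi> b\<bar>\<close> is \<open>\<psi> b\<close>, on the second it is
      \<open>- \<psi> b\<close>.\<close>
    show "open {x. - d < l (x - simplex_center)}" "open {x. l (x - simplex_center) < d}"
      by (intro open_Collect_less continuous_on_l continuous_intros)+
    show "simplex_boundary \<subseteq> {x. - d < l (x - simplex_center)} \<union> {x. l (x - simplex_center) < d}"
      using d by auto
  qed (use \<psi> \<psi>' in \<open>auto simp: profile_map_def Let_def abs_of_nonneg abs_of_nonpos\<close>)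
  also have "?P (\<lambda>b. \<bar>\<psi> b\<bar>) = 0"
    using nz(3) by (rule profile_one_sided [of _ "- 1"]) auto
  also have "?P (\<lambda>b. - \<bar>\<psi> b\<bar>) = 0"
    using nz(4) by (rule profile_one_sided [of _ 1]) auto
  also have "?P \<psi> = ?P (\<lambda>b. b)"
    by (rule profile_homotopy [symmetric]) (use cont zero' small in \<open>auto intro: continuous_intros\<close>)
  also have "\<dots> = 1"
    unfolding profile_map_id by (rule field_degree_identity [OF n2])
  also have "?P (\<lambda>b. - \<psi> b) = ?P (\<lambda>b. - b)"
  proof (rule profile_homotopy [symmetric])
    fix t b :: real assume "0 \<le> t" "t \<le> 1" "(1 - t) * - b + t * - \<psi> b = 0"
    then show "\<bar>b\<bar> * norm e < 1 / real CARD('n)"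
      using zero' [of t b] small by (simp add: algebra_simps)
  qed (auto intro!: continuous_intros cont)
  also have "profile_map (\<lambda>b. - b) = (\<lambda>x. (x - simplex_center) - (2 * l (x - simplex_center)) *\<^sub>R e)"
    by (simp add: profile_map_def Let_def fun_eq_iff scaleR_2 flip: scaleR_scaleR)
  finally show ?thesis by simp
qed

lemma reflection_kernel:
  assumes "v - (2 * l v) *\<^sub>R e = 0"
  shows "v = 0"
proof -
  have "l v - 2 * l v = 0"
    using arg_cong [OF assms, of l] lin le by (simp add: linear_diff linear_scale linear_0)
  then show ?thesis using assms by simp
qed

end

section \<open>Changing the degree of the identity field near a boundary point\<close>

text \<open>If the field at \<open>x\<close> were \<open>r\<close> times \<open>q - c\<close> with
  \<open>r \<ge> 0\<close>, then, \<open>T\<close> being injective and fixing \<open>q - c\<close>,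
  the vector \<open>x - c\<close> would be \<open>t x + r\<close> times \<open>q - c\<close>. Hence
  \<open>x = q\<close> and \<open>t q + r = 1\<close>, against \<open>t q > 1\<close>. The case
  \<open>r = 0\<close> gives nonvanishing, positive \<open>r\<close> a missed direction.\<close>

lemma field_degree_bump:
  fixes T :: "real^'n \<Rightarrow> real^'n" and q :: "real^'n"
  assumes n: "CARD('n) \<ge> 2" and T: "linear T" "\<And>v. v \<in> sum_zero \<Longrightarrow> T v \<in> sum_zero"
      "\<And>v. T v = 0 \<Longrightarrow> v = 0" "T (q - simplex_center) = q - simplex_center"
    and q: "q \<in> simplex_boundary"
    and t: "continuous_on simplex_boundary t" "\<And>x. t x \<ge> 0" "t q > 1"
  shows "nonzero_field (\<lambda>x. T (x - simplex_center) - t x *\<^sub>R (q - simplex_center))" (is "nonzero_field ?\<phi>")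
    and "field_degree (\<lambda>x. T (x - simplex_center) - t x *\<^sub>R (q - simplex_center)) = 0"
proof -
  have avoid: "?\<phi> x \<noteq> r *\<^sub>R (q - simplex_center)" if x: "x \<in> simplex_boundary" and r: "r \<ge> 0" for x r
  proof
    have "T (x - simplex_center - (t x + r) *\<^sub>R (q - simplex_center))
        = T (x - simplex_center) - (t x + r) *\<^sub>R (q - simplex_center)"
      by (simp only: linear_diff [OF T(1), of "x - simplex_center"] linear_scale [OF T(1)] T(4))
    moreover assume "?\<phi> x = r *\<^sub>R (q - simplex_center)"
    ultimately have "T (x - simplex_center - (t x + r) *\<^sub>R (q - simplex_center)) = 0"
      by (simp only: scaleR_left_distrib diff_diff_eq [symmetric] diff_self)
    then have ray: "x - simplex_center = (t x + r) *\<^sub>R (q - simplex_center)"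
      using T(3) by (metis right_minus_eq)
    then show False
      using boundary_ray_unique [OF x q _ ray] t(2) [of x] t(3) r by auto
  qed
  show nz: "nonzero_field ?\<phi>"
  proof (rule nonzero_fieldI)
    show "continuous_on simplex_boundary ?\<phi>"
      using T(1) unfolding linear_conv_bounded_linear
      by (intro continuous_intros t(1) bounded_linear.continuous_on [of T])
    fix x :: "real^'n" assume x: "x \<in> simplex_boundary"
    show "?\<phi> x \<in> sum_zero"
      by (intro sum_zero_linear_combination T(2) central_projection_boundary(1) x q)
    show "?\<phi> x \<noteq> 0" using avoid [OF x, of 0] by simp
  qed
  show "field_degree ?\<phi> = 0"
    using avoid central_projection_boundary [OF q]
    by (intro field_degree_missed_direction [OF n nz, of "q - simplex_center"]) auto
qed

text \<open>On \<open>A\<close> the field is the partially reflected \<open>?\<phi>0\<close>, on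
  \<open>B\<close> it is the fully reflected bump \<open>?R'\<close>. Exchanging with the plain
  reflection gives \<open>deg \<phi> + (- 1) = 1 + 0\<close>: \<open>?\<phi>0\<close> is homotopic
  to the identity and \<open>?R'\<close> misses a direction.\<close>

lemma (in oblique_axis) field_degree_flipped_bump:
  assumes q: "q \<in> simplex_boundary" and lq: "l (q - simplex_center) = 0"
    and t: "continuous_on simplex_boundary t" "\<And>x. t x \<ge> 0" "t q > 1"
    and s: "continuous_on simplex_boundary s" "\<And>x. 0 \<le> s x" "\<And>x. s x \<le> 1"
    and s_line: "\<And>x. x \<in> simplex_boundary \<Longrightarrow> s x > 0 \<Longrightarrow>
      x - simplex_center \<noteq> l (x - simplex_center) *\<^sub>R e"
    and AB: "open A" "open B" "simplex_boundary \<subseteq> A \<union> B"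
    and A: "\<And>x. x \<in> A \<Longrightarrow> t x = 0" and B: "\<And>x. x \<in> B \<Longrightarrow> s x = 1"
  defines "\<phi> \<equiv> \<lambda>x. (x - simplex_center) - (2 * s x * l (x - simplex_center)) *\<^sub>R e
      - t x *\<^sub>R (q - simplex_center)"
  shows "nonzero_field \<phi>" and "field_degree \<phi> = 2"
proof -
  let ?c = "simplex_center :: real^'n"
  let ?\<phi>0 = "\<lambda>x. (x - ?c) - (2 * s x * l (x - ?c)) *\<^sub>R e"
  let ?R = "\<lambda>x. (x - ?c) - (2 * l (x - ?c)) *\<^sub>R e"
  let ?R' = "\<lambda>x. ?R x - t x *\<^sub>R (q - ?c)"
  note l = continuous_on_l
  have linR: "linear (\<lambda>v. v - (2 * l v) *\<^sub>R e)"
    using lin by (intro linearI) (simp_all add: linear_add linear_scale algebra_simps)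
  note bump = field_degree_bump [OF n2 linR, of q t]
  have R': "nonzero_field ?R'" "field_degree ?R' = 0"
    by (rule bump; use e q lq t reflection_kernel in auto)+
  have R: "nonzero_field ?R"
  proof (rule nonzero_fieldI)
    fix x :: "real^'n" assume x: "x \<in> simplex_boundary"
    show "?R x \<in> sum_zero"
      by (intro sum_zero_linear_combination e central_projection_boundary(1) x)
    show "?R x \<noteq> 0"
      using reflection_kernel [of "x - ?c"] central_projection_boundary(2) [OF x] by auto
  next
    show "continuous_on simplex_boundary ?R"
      by (intro continuous_intros l)
  qed
  have line: "l y = 0 \<or> (2 * a = 1 \<and> y = l y *\<^sub>R e)" if "y - (2 * a * l y) *\<^sub>R e = 0" for y a
  proof -
    have "l y - 2 * a * l y = 0"
      using arg_cong [OF that, of l] lin le by (simp add: linear_diff linear_scale linear_0)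
    then have "l y = 0 \<or> 2 * a = 1" by (simp add: algebra_simps)
    then show ?thesis using that by auto
  qed
  \<comment> \<open>Scaling the cutoff \<open>s\<close> by \<open>a\<close> connects the identity
    with \<open>?\<phi>0\<close>. By \<open>line\<close> a zero would need \<open>s x > 0\<close> on
    the axis of \<open>e\<close>, which \<open>s_line\<close> excludes.\<close>
  have hom: "(x - ?c) - (2 * (a * s x) * l (x - ?c)) *\<^sub>R e \<noteq> 0"
    if x: "x \<in> simplex_boundary" and "0 \<le> a" "a \<le> 1" for x a
  proof
    assume 0: "(x - ?c) - (2 * (a * s x) * l (x - ?c)) *\<^sub>R e = 0"
    from line [OF this] show False
    proof (elim disjE conjE)
      assume "l (x - ?c) = 0"
      then show False using 0 central_projection_boundary(2) [OF x] by simp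
    next
      assume *: "2 * (a * s x) = 1" "x - ?c = l (x - ?c) *\<^sub>R e"
      then have "s x > 0" using s(2) [of x] by (cases "s x = 0") auto
      then show False using s_line x * by blast
    qed
  qed
  have \<phi>0: "nonzero_field ?\<phi>0"
  proof (rule nonzero_fieldI)
    fix x :: "real^'n" assume x: "x \<in> simplex_boundary"
    show "?\<phi>0 x \<in> sum_zero"
      by (intro sum_zero_linear_combination e central_projection_boundary(1) x)
    show "?\<phi>0 x \<noteq> 0" using hom [OF x, of 1] by simp
  next
    show "continuous_on simplex_boundary ?\<phi>0"
      by (intro continuous_intros l s)
  qed
  have "field_degree (\<lambda>x. x - ?c) = field_degree ?\<phi>0"
  proof (rule field_degree_homotopy [OF n2 nonzero_field_identity \<phi>0])
    fix x :: "real^'n" and a :: real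
    assume "x \<in> simplex_boundary" "0 \<le> a" "a \<le> 1"
    then show "(1 - a) *\<^sub>R (x - ?c) + a *\<^sub>R ?\<phi>0 x \<noteq> 0"
      using hom [of x a] by (simp add: algebra_simps)
  qed
  then have \<phi>0': "field_degree ?\<phi>0 = 1" using field_degree_identity [OF n2] by simp
  show nz: "nonzero_field \<phi>"
  proof (rule nonzero_fieldI)
    show "continuous_on simplex_boundary \<phi>"
      unfolding \<phi>_def by (intro continuous_intros l s t)
    fix x :: "real^'n" assume x: "x \<in> simplex_boundary"
    show "\<phi> x \<in> sum_zero"
      unfolding \<phi>_def by (intro sum_zero_linear_combination e central_projection_boundary(1) x q)
    show "\<phi> x \<noteq> 0"
    proof (cases "x \<in> A")
      case True
      then show ?thesis using A x \<phi>0 by (auto simp: \<phi>_def nonzero_field_def)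
    next
      case False
      then have "x \<in> B" using AB x by blast
      then have "\<phi> x = ?R' x" using B by (simp add: \<phi>_def)
      then show ?thesis using R'(1) x by (auto simp: nonzero_field_def)
    qed
  qed
  have "field_degree \<phi> + field_degree ?R = field_degree ?\<phi>0 + field_degree ?R'"
    by (rule field_degree_exchange [OF n2 nz R \<phi>0 R'(1) AB]) (use A B in \<open>auto simp: \<phi>_def\<close>)
  then show "field_degree \<phi> = 2"
    using \<phi>0' R'(2) field_degree_reflection by simp
qed

text \<open>Induction: away from \<open>C j\<close> the summand \<open>D j\<close> vanishes, away
  from the other supports the remaining sum does. The exchange thus trades the full sum and the
  identity for the two partial modifications.\<close>

lemma field_degree_disjoint_sum:
  fixes D :: "'i \<Rightarrow> real^'n \<Rightarrow> real^'n"
  assumes n: "CARD('n) \<ge> 2" and "finite \<Theta>"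
    and nz: "\<And>i. i \<in> \<Theta> \<Longrightarrow> nonzero_field (\<lambda>x. x - simplex_center + D i x)"
    and C: "\<And>i. i \<in> \<Theta> \<Longrightarrow> closed (C i)" "\<And>i x. i \<in> \<Theta> \<Longrightarrow> x \<notin> C i \<Longrightarrow> D i x = 0"
    and dis: "disjoint_family_on C \<Theta>"
  shows "nonzero_field (\<lambda>x. x - simplex_center + (\<Sum>i\<in>\<Theta>. D i x)) \<and>
    field_degree (\<lambda>x. x - simplex_center + (\<Sum>i\<in>\<Theta>. D i x))
      = 1 + (\<Sum>i\<in>\<Theta>. field_degree (\<lambda>x. x - simplex_center + D i x) - 1)"
  using \<open>finite \<Theta>\<close> nz C dis
proof (induction \<Theta> rule: finite_induct)
  case empty
  then show ?case using nonzero_field_identity field_degree_identity [OF n] by simp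
next
  case (insert j \<Theta>)
  let ?c = "simplex_center :: real^'n"
  let ?S = "\<lambda>x. \<Sum>i\<in>\<Theta>. D i x" and ?U = "\<Union>i\<in>\<Theta>. C i"
  have "disjoint_family_on C \<Theta>"
    using insert.prems(4) by (rule disjoint_family_on_mono [rotated]) auto
  then have IH: "nonzero_field (\<lambda>x. x - ?c + ?S x)"
      "field_degree (\<lambda>x. x - ?c + ?S x) = 1 + (\<Sum>i\<in>\<Theta>. field_degree (\<lambda>x. x - ?c + D i x) - 1)"
    using insert by auto
  have j: "nonzero_field (\<lambda>x. x - ?c + D j x)" using insert.prems by auto
  have cl: "closed ?U" "closed (C j)" using insert by auto
  have op: "open (- C j)" "open (- ?U)"
    using cl by (simp_all only: open_Compl)
  have cover: "- C j \<union> - ?U = UNIV"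
    using insert.prems(4) insert.hyps(2) by (fastforce simp: disjoint_family_on_def)
  have Dj: "D j x = 0" if "x \<in> - C j" for x using insert.prems(3) that by auto
  have S: "?S x = 0" if "x \<in> - ?U" for x using insert.prems(3) that by (intro sum.neutral) auto
  have nz': "nonzero_field (\<lambda>x. x - ?c + (D j x + ?S x))"
  proof (rule nonzero_fieldI)
    have "continuous_on simplex_boundary (\<lambda>x. x - ?c + D j x)"
      "continuous_on simplex_boundary (\<lambda>x. x - ?c + ?S x)"
      using IH(1) j by (auto simp: nonzero_field_def)
    \<comment> \<open>Continuity is known for the fields, not for the summands, so the sum is
      written as two fields minus the identity.\<close>
    then have "continuous_on simplex_boundary (\<lambda>x. (x - ?c + D j x) + (x - ?c + ?S x) - (x - ?c))"
      by (rule continuous_on_diff [OF continuous_on_add]) (intro continuous_intros)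
    then show "continuous_on simplex_boundary (\<lambda>x. x - ?c + (D j x + ?S x))"
      by (simp add: algebra_simps)
    fix x :: "real^'n" assume x: "x \<in> simplex_boundary"
    consider "x \<in> - C j" | "x \<in> - ?U" using cover by blast
    then have "x - ?c + (D j x + ?S x) \<in> sum_zero - {0}"
      using Dj S IH(1) j x by cases (auto simp: nonzero_field_def)
    then show "x - ?c + (D j x + ?S x) \<in> sum_zero" "x - ?c + (D j x + ?S x) \<noteq> 0"
      by auto
  qed
  have "field_degree (\<lambda>x. x - ?c + (D j x + ?S x)) + field_degree (\<lambda>x. x - ?c)
      = field_degree (\<lambda>x. x - ?c + ?S x) + field_degree (\<lambda>x. x - ?c + D j x)"
    by (rule field_degree_exchange [OF n nz' nonzero_field_identity IH(1) j op])
      (use cover Dj S in auto)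
  then show ?case
    using insert.hyps nz' IH(2) field_degree_identity [OF n] by simp
qed

section \<open>Binomial coefficients of a number that is not a prime power\<close>

text \<open>If \<open>p\<close> does not divide \<open>n\<close>, take \<open>k = n - 1\<close>,
  which is at least 2 because 2 is itself a prime power. Otherwise take for \<open>k\<close> the
  full power of \<open>p\<close> in \<open>n\<close>, which is less than \<open>n\<close> because
  \<open>n\<close> is not a prime power.\<close>

lemma prime_not_dvd_binomial:
  fixes n p :: nat
  assumes n: "n \<ge> 2" "\<not> primepow n" and p: "prime p"
  shows "\<exists>k\<in>{2..<n}. \<not> p dvd (n choose k)"
proof (cases "p dvd n")
  case False
  have "n \<noteq> 2" using n(2) by (metis primepow_prime two_is_prime_nat)
  then have "n - 1 \<in> {2..<n}" "n choose (n - 1) = n"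
    using n(1) binomial_symmetric [of 1 n] by auto
  then show ?thesis using False by metis
next
  case True
  have "n \<noteq> 0" "\<not> is_unit p" using n p by auto
  then obtain r where r: "n = p ^ multiplicity p n * r" "\<not> p dvd r"
    using multiplicity_decompose' [of n p] by metis
  define m where "m = multiplicity p n"
  have m: "m > 0" using True \<open>n \<noteq> 0\<close> p unfolding m_def by (simp add: prime_multiplicity_gt_zero_iff)
  have "r \<noteq> 1"
  proof
    assume "r = 1"
    then have "primepow n" using r(1) m p by (metis m_def mult.right_neutral primepow_prime_power)
    then show False using n(2) by simp
  qed
  moreover have "r \<noteq> 0" using r(2) by (metis dvd_0_right)
  ultimately have r1: "r > 1" by simp
  have pm: "p ^ m \<ge> 2"
    using m p by (metis One_nat_def less_eq_Suc_le one_le_numeral order_trans power_increasing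
        power_one_right prime_ge_1_nat prime_ge_2_nat)
  have "p ^ m < n" using r(1) r1 pm unfolding m_def [symmetric]
    by (metis mult.right_neutral mult_less_cancel1 not_less numeral_2_eq_2 not_less_eq_eq le0 neq0_conv)
  moreover have "\<not> p dvd (n choose p ^ m)"
  proof -
    \<comment> \<open>By \<open>const_p_fac\<close> the multiplicity of \<open>p\<close> in this
      binomial coefficient equals that in the cofactor \<open>r\<close>.\<close>
    have "multiplicity p (n choose p ^ m) = 0"
      using const_p_fac [of r p m] p r r1 unfolding m_def [symmetric]
      by (simp add: not_dvd_imp_multiplicity_0)
    moreover have "n choose p ^ m \<noteq> 0" using \<open>p ^ m < n\<close> by simp
    ultimately show ?thesis using p by (simp add: prime_elem_multiplicity_eq_zero_iff)
  qed
  ultimately show ?thesis using pm by (intro bexI [of _ "p ^ m"]) auto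
qed

lemma Gcd_image_combination:
  fixes g :: "'a \<Rightarrow> int"
  assumes "finite A"
  shows "\<exists>a. (\<Sum>k\<in>A. a k * g k) = Gcd (g ` A)"
  using assms
proof (induction A rule: finite_induct)
  case (insert j A)
  then obtain a where a: "(\<Sum>k\<in>A. a k * g k) = Gcd (g ` A)" by blast
  obtain u v where uv: "u * g j + v * Gcd (g ` A) = gcd (g j) (Gcd (g ` A))"
    using bezout_int by blast
  let ?b = "\<lambda>k. if k = j then u else v * a k"
  have "(\<Sum>k\<in>insert j A. ?b k * g k) = u * g j + (\<Sum>k\<in>A. ?b k * g k)"
    using insert.hyps by simp
  also have "(\<Sum>k\<in>A. ?b k * g k) = (\<Sum>k\<in>A. v * (a k * g k))"
    using insert.hyps by (intro sum.cong) auto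
  also have "\<dots> = v * Gcd (g ` A)"
    by (simp add: a flip: sum_distrib_left)
  finally show ?case using uv by (intro exI [of _ ?b]) simp
qed simp

text \<open>No prime divides all these coefficients, so their gcd is 1 and Bezout applies. The
  target \<open>- 1\<close> cancels the degree 1 of the identity field.\<close>

lemma binomial_combination:
  fixes n :: nat
  assumes "n \<ge> 2" "\<not> primepow n"
  shows "\<exists>a::nat \<Rightarrow> int. (\<Sum>k\<in>{2..<n}. a k * int (n choose k)) = - 1"
proof -
  let ?G = "Gcd ((\<lambda>k. int (n choose k)) ` {2..<n})"
  have "?G = 1"
  proof (rule ccontr)
    assume "?G \<noteq> 1"
    then have "\<not> is_unit (nat ?G)" by (simp add: nat_eq_iff)
    then obtain p where p: "prime p" "p dvd nat ?G"
      by (metis prime_factor_nat nat_dvd_1_iff_1)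
    have "p dvd (n choose k)" if "k \<in> {2..<n}" for k
    proof -
      have "int p dvd ?G" using p(2) by (metis Gcd_int_greater_eq_0 int_dvd_int_iff nat_0_le)
      also have "?G dvd int (n choose k)" using that by (intro Gcd_dvd) auto
      finally show ?thesis by simp
    qed
    then show False using prime_not_dvd_binomial [OF assms p(1)] by blast
  qed
  then obtain a where "(\<Sum>k\<in>{2..<n}. a k * int (n choose k)) = 1"
    using Gcd_image_combination [of "{2..<n}" "\<lambda>k. int (n choose k)"] by auto
  then show ?thesis
    by (intro exI [of _ "\<lambda>k. - a k"]) (simp add: sum_negf)
qed

section \<open>Bumps at points of the faces\<close>

text \<open>This is \<open>face_sigma\<close> with \<open>face_perm\<close> replaced by an arbitrary
  map, so that its linearity and isometry can be treated without reference to faces.\<close>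

definition permute_coords :: "('n \<Rightarrow> 'n) \<Rightarrow> real^'n \<Rightarrow> real^'n" where
  "permute_coords \<pi> t = (\<chi> j. t $ inv_into UNIV \<pi> j)"

lemma permute_coords_nth: "bij \<pi> \<Longrightarrow> permute_coords \<pi> t $ \<pi> i = t $ i"
  by (simp add: permute_coords_def bij_is_inj)

lemma permute_coords_eqI:
  assumes "bij \<pi>" "\<And>i. u $ \<pi> i = t $ i"
  shows "permute_coords \<pi> t = u"
  unfolding vec_eq_iff
  by (metis assms bij_pointE permute_coords_nth)

lemma linear_permute_coords: "linear (permute_coords \<pi>)"
  by (rule linearI) (simp_all add: permute_coords_def vec_eq_iff)

lemma permute_coords_center [simp]: "permute_coords \<pi> simplex_center = simplex_center"
  by (simp add: permute_coords_def vec_eq_iff simplex_center_def)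

lemma norm_permute_coords:
  assumes "bij \<pi>"
  shows "norm (permute_coords \<pi> t) = norm t"
proof -
  have "(\<Sum>j\<in>UNIV. (t $ inv_into UNIV \<pi> j)\<^sup>2) = (\<Sum>i\<in>UNIV. (t $ i)\<^sup>2)"
    by (rule sum.reindex_bij_betw [of "inv_into UNIV \<pi>" UNIV UNIV "\<lambda>i. (t $ i)\<^sup>2"])
      (rule bij_imp_bij_inv [OF assms])
  then show ?thesis
    by (simp add: norm_vec_def L2_set_def permute_coords_def)
qed

lemma dist_permute_coords:
  assumes "bij \<pi>"
  shows "dist (permute_coords \<pi> s) (permute_coords \<pi> t) = dist s t"
  by (simp add: dist_norm norm_permute_coords [OF assms] flip: linear_diff [OF linear_permute_coords])

lemma Min_image_strict_mono_on:
  fixes \<pi> :: "'a::linorder \<Rightarrow> 'b::linorder"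
  assumes "finite I" "I \<noteq> {}" "strict_mono_on I \<pi>"
  shows "Min (\<pi> ` I) = \<pi> (Min I)" "Max (\<pi> ` I) = \<pi> (Max I)"
proof -
  have "mono_on I \<pi>" using assms(3) by (rule strict_mono_on_imp_mono_on)
  then have "\<pi> (Min I) \<le> \<pi> i" "\<pi> i \<le> \<pi> (Max I)" if "i \<in> I" for i
    using assms(1,2) that by (simp_all add: mono_on_def)
  moreover have "Min I \<in> I" "Max I \<in> I" using assms(1,2) by simp_all
  ultimately show "Min (\<pi> ` I) = \<pi> (Min I)" "Max (\<pi> ` I) = \<pi> (Max I)"
    using assms(1) by (auto intro!: Min_eqI Max_eqI imageI)
qed

text \<open>
  For \<open>m < M\<close> the centers are distinct interior points of the face of \<open>I\<close>, moved off its barycenter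
  towards the vertex \<open>Min I\<close> and away from \<open>Max I\<close>; order-preserving bijections respect this choice. The
  form \<open>bump_form\<close> vanishes on \<open>q - c\<close> for the center \<open>q\<close>, and the multiple \<open>bump_axis\<close> of
  \<open>e\<^bsub>Min I\<^esub> - e\<^bsub>Max I\<^esub>\<close> has value 1 under it because \<open>q\<^bsub>Min I\<^esub> + q\<^bsub>Max I\<^esub> = 2 / |I|\<close>. The factor \<open>32 n M\<close>
  makes the supports so small that they are pairwise disjoint and meet only faces containing \<open>I\<close>.
\<close>

context
  fixes M :: nat and I :: "'n::{finite,linorder} set" and m :: nat
begin

definition bump_center :: "real^'n::{finite,linorder}" where
  "bump_center = (\<chi> i. of_bool (i \<in> I) / card I
     + real m / (2 * M * card I) * (of_bool (i = Min I) - of_bool (i = Max I)))"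

definition bump_form :: "real^'n::{finite,linorder} \<Rightarrow> real" where
  "bump_form y = (bump_center - simplex_center) $ Max I * y $ Min I
     - (bump_center - simplex_center) $ Min I * y $ Max I"

definition bump_axis :: "real^'n::{finite,linorder}" where
  "bump_axis = (1 / (2 / card I - 2 / CARD('n))) *\<^sub>R (axis (Min I) 1 - axis (Max I) 1)"

definition bump_dist :: "real^'n::{finite,linorder} \<Rightarrow> real" where
  "bump_dist x = 32 * CARD('n) * M * dist x bump_center"

text \<open>The reflection is complete up to \<open>bump_dist\<close> 3 and fades out at 4, while
  the multiple of \<open>q - c\<close> vanishes from 2 on and equals 2 at \<open>q\<close>. So the
  regions beyond 2 and below 3 form the cover required by
  \<open>field_degree_flipped_bump\<close>.\<close>

definition bump :: "bool \<Rightarrow> real^'n::{finite,linorder} \<Rightarrow> real^'n::{finite,linorder}" where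
  "bump b x =
     - (of_bool b * 2 * min 1 (max 0 (4 - bump_dist x)) * bump_form (x - simplex_center)) *\<^sub>R bump_axis
     - max 0 (2 - bump_dist x) *\<^sub>R (bump_center - simplex_center)"

definition bump_support :: "(real^'n::{finite,linorder}) set" where
  "bump_support = {x. bump_dist x \<le> 4}"

end

text \<open>Being monotone on \<open>I\<close>, the permutation carries \<open>Min I\<close> and
  \<open>Max I\<close> to the extremes of the image, hence center, form and axis along with it, and
  it preserves distances. Coordinates outside \<open>I\<close> are treated alike, which is why they
  may be permuted arbitrarily.\<close>

lemma permute_bump:
  fixes \<pi> :: "'n::{finite,linorder} \<Rightarrow> 'n"
  assumes bij: "bij \<pi>" and mono: "strict_mono_on I \<pi>" and I: "I \<noteq> {}"
  shows "bump M (\<pi> ` I) m b (permute_coords \<pi> x) = permute_coords \<pi> (bump M I m b x)"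
proof -
  have inj: "inj \<pi>" using bij by (rule bij_is_inj)
  have card: "card (\<pi> ` I) = card I" by (meson card_image inj inj_on_subset subset_UNIV)
  note MM = Min_image_strict_mono_on [OF finite I mono]
  have c: "bump_center M (\<pi> ` I) m = permute_coords \<pi> (bump_center M I m)"
    by (rule permute_coords_eqI [OF bij, symmetric])
      (simp add: bump_center_def MM card inj_eq [OF inj] inj_image_mem_iff [OF inj])
  have d: "bump_dist M (\<pi> ` I) m (permute_coords \<pi> x) = bump_dist M I m x"
    by (simp add: bump_dist_def c dist_permute_coords [OF bij])
  have a: "bump_axis (\<pi> ` I) = permute_coords \<pi> (bump_axis I)"
    by (rule permute_coords_eqI [OF bij, symmetric])
      (simp add: bump_axis_def MM card axis_def inj_eq [OF inj])
  have "(permute_coords \<pi> t - simplex_center) $ \<pi> i = (t - simplex_center) $ i" for t i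
    using permute_coords_nth [OF bij, of "t - simplex_center" i]
    by (simp add: linear_diff [OF linear_permute_coords])
  then have f: "bump_form M (\<pi> ` I) m (permute_coords \<pi> x - simplex_center)
      = bump_form M I m (x - simplex_center)"
    unfolding bump_form_def c MM by simp
  show ?thesis
    by (simp add: bump_def d f a c linear_diff [OF linear_permute_coords]
        linear_scale [OF linear_permute_coords] linear_neg [OF linear_permute_coords])
qed

lemma bump_eq_0:
  assumes "x \<notin> bump_support M I m"
  shows "bump M I m b x = 0"
  using assms by (simp add: bump_def bump_support_def)

lemma closed_bump_support: "closed (bump_support M I m)"
  unfolding bump_support_def bump_dist_def
  by (intro closed_Collect_le continuous_intros)

section \<open>Position and degree of a single bump\<close>

locale bump_index =
  fixes M :: nat and I :: "'n::{finite,linorder} set" and m :: nat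
  assumes card_ge: "card I \<ge> 2" and card_less: "card I < CARD('n)" and m: "m < M"
begin

abbreviation "q \<equiv> bump_center M I m"

lemma finite_ne: "finite I" "I \<noteq> {}"
proof -
  show "finite I" by simp
  show "I \<noteq> {}" using card_ge by auto
qed

lemma Min_Max: "Min I \<in> I" "Max I \<in> I" "Min I \<noteq> Max I"
proof -
  show "Min I \<in> I" "Max I \<in> I" using finite_ne by auto
  show "Min I \<noteq> Max I"
  proof
    assume "Min I = Max I"
    then have "i = Min I" if "i \<in> I" for i
      using that by (metis Max_ge Min_le antisym finite)
    then have "I \<subseteq> {Min I}" by blast
    then have "card I \<le> 1" using card_mono [of "{Min I}" I] by simp
    then show False using card_ge by simp
  qed
qed

lemma shift_less: "real m / (2 * M * card I) \<le> 1 / (2 * card I)"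
  using m card_ge by (simp add: field_simps)

lemma center_outside: "i \<notin> I \<Longrightarrow> q $ i = 0"
  using Min_Max by (auto simp: bump_center_def)

text \<open>The shift takes away at most half of the barycentric coordinate
  \<open>1 / card I\<close>. The remainder exceeds the support radius, which is at most
  \<open>1 / (8 * n)\<close>.\<close>

lemma center_inside:
  assumes "i \<in> I"
  shows "q $ i \<ge> 1 / (2 * CARD('n))"
proof -
  have "1 / real (card I) - 1 / (2 * card I) \<ge> 1 / (2 * CARD('n))"
    using card_ge card_less by (simp add: field_simps)
  moreover have "q $ i \<ge> 1 / card I - real m / (2 * M * card I)"
    using assms by (simp add: bump_center_def)
  ultimately show ?thesis using shift_less by linarith
qed

lemma center_nonneg: "q $ i \<ge> 0"
  using center_outside [of i] center_inside [of i] by (cases "i \<in> I") (auto intro: order_trans [rotated])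

lemma center_boundary: "q \<in> simplex_boundary"
proof -
  have "(\<Sum>i\<in>UNIV. of_bool (i = j) :: real) = 1" for j :: 'n
    by (simp add: of_bool_def)
  moreover have "(\<Sum>i\<in>UNIV. of_bool (i \<in> I) / card I :: real) = 1"
    using finite_ne by (simp add: of_bool_def sum.If_cases flip: sum_divide_distrib)
  ultimately have "(\<Sum>i\<in>UNIV. q $ i) = 1"
    by (simp only: bump_center_def vec_lambda_beta sum.distrib sum_subtractf flip: sum_distrib_left) simp
  moreover have "\<exists>i. i \<notin> I"
    using card_less by (metis UNIV_eq_I less_irrefl)
  ultimately show ?thesis
    using center_nonneg center_outside by (auto simp: simplex_boundary_def unit_simplex_def)
qed

lemma center_Min_Max: "q $ Min I + q $ Max I = 2 / card I"
  using Min_Max by (simp add: bump_center_def)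

lemma center_coeff: "2 / card I - 2 / CARD('n) > (0::real)"
  using card_ge card_less by (simp add: field_simps)

lemma M_pos: "M > 0" using m by simp

lemma in_supportD:
  assumes "x \<in> bump_support M I m"
  shows "dist x q \<le> 1 / (8 * real CARD('n) * real M)"
  using assms M_pos by (simp add: bump_support_def bump_dist_def field_simps)

lemma support_component:
  assumes "x \<in> bump_support M I m"
  shows "\<bar>x $ i - q $ i\<bar> \<le> 1 / (8 * real CARD('n) * real M)"
  using in_supportD [OF assms] component_le_norm_cart [of "x - q" i] by (simp add: dist_norm)

lemma radius_le: "1 / (8 * real CARD('n) * real M) \<le> 1 / (8 * real CARD('n))"
  using M_pos by (simp add: field_simps)

text \<open>Near the center all coordinates in \<open>I\<close> stay positive. Hence on the face of
  \<open>K\<close> only bumps with \<open>I\<close> inside \<open>K\<close> are visible, and there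
  the permutation of \<open>K\<close> is monotone on \<open>I\<close>.\<close>

lemma support_face:
  assumes "x \<in> bump_support M I m" "x \<in> simplex_face K"
  shows "I \<subseteq> K"
proof
  fix i assume "i \<in> I"
  show "i \<in> K"
  proof (rule ccontr)
    assume "i \<notin> K"
    then have "x $ i = 0" using assms(2) by (simp add: simplex_face_def)
    then have "1 / (2 * real CARD('n)) \<le> 1 / (8 * real CARD('n))"
      using support_component [OF assms(1), of i] center_inside [OF \<open>i \<in> I\<close>] radius_le by simp
    then show False by (simp add: field_simps)
  qed
qed

sublocale oblique_axis "bump_form M I m" "bump_axis I"
proof (rule oblique_axis.intro)
  show "CARD('n) \<ge> 2" using card_ge card_less by simp
  show "linear (bump_form M I m)"
    by (rule linearI) (simp_all add: bump_form_def algebra_simps)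
  note lin_form = this
  show "bump_axis I \<in> sum_zero"
    unfolding bump_axis_def
    by (intro sum_zero_linear_combination(4)) (simp add: sum_zero_def sum_subtractf axis_def)
  have "bump_form M I m (axis (Min I) 1 - axis (Max I) 1) = 2 / card I - 2 / CARD('n)"
    using Min_Max center_Min_Max by (simp add: bump_form_def axis_def simplex_center_def)
  then have "bump_form M I m (bump_axis I) = (1 / (2 / card I - 2 / CARD('n))) * (2 / card I - 2 / CARD('n))"
    by (simp add: bump_axis_def linear_scale [OF lin_form])
  then show "bump_form M I m (bump_axis I) = 1"
    using center_coeff card_less by simp
qed

text \<open>At an index outside \<open>I\<close> the axis vanishes, so equality would give the
  coordinate \<open>1/n\<close>, whereas near the center it is at most \<open>1 / (8 * n)\<close>.
  This supplies the hypothesis \<open>s_line\<close> of the flipped bump.\<close>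

lemma support_off_axis:
  assumes "x \<in> bump_support M I m"
  shows "x - simplex_center \<noteq> r *\<^sub>R bump_axis I"
proof
  assume eq: "x - simplex_center = r *\<^sub>R bump_axis I"
  obtain i where i: "i \<notin> I" using card_less by (metis UNIV_eq_I less_irrefl)
  then have "(r *\<^sub>R bump_axis I) $ i = 0"
    using Min_Max by (auto simp: bump_axis_def axis_def)
  then have "(x - simplex_center) $ i = 0" unfolding eq .
  then have "x $ i = 1 / real CARD('n)"
    by (simp add: simplex_center_def)
  then have "1 / real CARD('n) \<le> 1 / (8 * real CARD('n))"
    using support_component [OF assms, of i] radius_le center_outside [OF i] by simp
  then show False by (simp add: field_simps)
qed

lemma field_degree_bump_eq:
  "nonzero_field (\<lambda>x. x - simplex_center + bump M I m b x)"
  "field_degree (\<lambda>x. x - simplex_center + bump M I m b x) = (if b then 2 else 0)"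
proof -
  let ?t = "\<lambda>x. max 0 (2 - bump_dist M I m x)" and ?s = "\<lambda>x. min 1 (max 0 (4 - bump_dist M I m x))"
  have dist: "continuous_on S (bump_dist M I m)" for S
    unfolding bump_dist_def by (intro continuous_intros)
  have t: "continuous_on simplex_boundary ?t" "\<And>x. ?t x \<ge> 0" "?t q > 1"
    by (intro continuous_intros dist) (simp_all add: bump_dist_def)
  have lq: "bump_form M I m (q - simplex_center) = 0"
    by (simp add: bump_form_def)
  have "nonzero_field (\<lambda>x. x - simplex_center + bump M I m b x) \<and>
    field_degree (\<lambda>x. x - simplex_center + bump M I m b x) = (if b then 2 else 0)"
  proof (cases b)
    case False
    have "linear (\<lambda>v. v)" by (simp add: linearI)
    from field_degree_bump [OF n2 this _ _ _ center_boundary t] show ?thesis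
      using False by (simp add: bump_def)
  next
    case True
    have A: "open {x. bump_dist M I m x > 2}" and B: "open {x. bump_dist M I m x < 3}"
      by (intro open_Collect_less dist continuous_intros)+
    have s: "continuous_on simplex_boundary ?s" "\<And>x. 0 \<le> ?s x" "\<And>x. ?s x \<le> 1"
      by (intro continuous_intros dist) simp_all
    have "x - simplex_center \<noteq> bump_form M I m (x - simplex_center) *\<^sub>R bump_axis I"
      if "x \<in> simplex_boundary" "?s x > 0" for x
      using that by (intro support_off_axis) (simp add: bump_support_def)
    moreover have "simplex_boundary \<subseteq> {x. bump_dist M I m x > 2} \<union> {x. bump_dist M I m x < 3}"
      by auto
    ultimately have flipped:
      "nonzero_field (\<lambda>x. (x - simplex_center)
        - (2 * ?s x * bump_form M I m (x - simplex_center)) *\<^sub>R bump_axis I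
        - ?t x *\<^sub>R (q - simplex_center))"
      "field_degree (\<lambda>x. (x - simplex_center)
        - (2 * ?s x * bump_form M I m (x - simplex_center)) *\<^sub>R bump_axis I
        - ?t x *\<^sub>R (q - simplex_center)) = 2"
      by (intro field_degree_flipped_bump [OF center_boundary lq t s _ A B]; simp)+
    have "(\<lambda>x. x - simplex_center + bump M I m b x) = (\<lambda>x. (x - simplex_center)
        - (2 * ?s x * bump_form M I m (x - simplex_center)) *\<^sub>R bump_axis I
        - ?t x *\<^sub>R (q - simplex_center))"
      using True by (simp add: bump_def fun_eq_iff)
    then show ?thesis
      using True flipped by auto
  qed
  then show "nonzero_field (\<lambda>x. x - simplex_center + bump M I m b x)"
    "field_degree (\<lambda>x. x - simplex_center + bump M I m b x) = (if b then 2 else 0)"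
    by auto
qed

end

text \<open>Overlapping supports would put all coordinates of the centers within
  \<open>1 / (4 * n * M)\<close>. Different faces differ by at least \<open>1 / (2 * n)\<close> in
  some coordinate; different levels on one face differ at \<open>Min I\<close> by at least
  \<open>1 / (2 * M * card I)\<close>.\<close>

lemma bump_support_disjoint:
  fixes I J :: "'n::{finite,linorder} set"
  assumes "bump_index M I m" "bump_index M J k" "(I, m) \<noteq> (J, k)"
  shows "bump_support M I m \<inter> bump_support M J k = {}"
proof (rule ccontr)
  interpret I: bump_index M I m by fact
  interpret J: bump_index M J k by fact
  let ?n = "real CARD('n)"
  assume "bump_support M I m \<inter> bump_support M J k \<noteq> {}"
  then obtain x where x: "x \<in> bump_support M I m" "x \<in> bump_support M J k" by blast
  have close: "\<bar>bump_center M I m $ i - bump_center M J k $ i\<bar> \<le> 1 / (4 * ?n * real M)" for i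
  proof -
    have "1 / (4 * ?n * real M) = 1 / (8 * ?n * M) + 1 / (8 * ?n * M)"
      using I.M_pos by (simp add: field_simps)
    then show ?thesis
      using I.support_component [OF x(1), of i] J.support_component [OF x(2), of i] by linarith
  qed
  have "1 / (4 * ?n * real M) \<le> 1 / (4 * ?n)" using I.M_pos by (simp add: field_simps)
  also have "\<dots> < 1 / (2 * ?n)" by (simp add: field_simps)
  finally have lt: "1 / (4 * ?n * real M) < 1 / (2 * ?n)" .
  have "I = J"
  proof (rule ccontr)
    assume "I \<noteq> J"
    then obtain i where "i \<in> I \<and> i \<notin> J \<or> i \<in> J \<and> i \<notin> I" by blast
    then show False
      using close [of i] lt I.center_inside [of i] J.center_inside [of i]
        I.center_outside [of i] J.center_outside [of i] by (elim disjE) auto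
  qed
  then have "m \<noteq> k" using assms(3) by simp
  have "bump_center M I m $ Min I - bump_center M J k $ Min I = (real m - real k) / (2 * real M * real (card I))"
    using I.Min_Max by (simp add: bump_center_def \<open>I = J\<close> [symmetric] diff_divide_distrib)
  then have "\<bar>real m - real k\<bar> / (2 * real M * real (card I)) \<le> 1 / (4 * ?n * real M)"
    using close [of "Min I"] by (simp add: abs_div)
  moreover have "1 \<le> \<bar>real m - real k\<bar>" using \<open>m \<noteq> k\<close> by linarith
  then have "1 / (2 * real M * real (card I)) \<le> \<bar>real m - real k\<bar> / (2 * real M * real (card I))"
    by (intro divide_right_mono) auto
  ultimately have "1 / (2 * real M * real (card I)) \<le> 1 / (4 * ?n * real M)" by linarith
  then have "4 * ?n * real M \<le> 2 * real M * real (card I)"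
    using I.M_pos I.card_ge by (subst (asm) frac_le_eq) (auto simp: field_simps)
  then have "2 * ?n \<le> real (card I)" using I.M_pos by simp
  then show False using I.card_less by simp
qed

section \<open>Assembling the bumps and shrinking the field into the simplex\<close>

lemma sum_over_subsets_by_card:
  fixes g :: "nat \<Rightarrow> int"
  shows "(\<Sum>I\<in>{I::'n::finite set. 2 \<le> card I \<and> card I < CARD('n)}. g (card I))
    = (\<Sum>k\<in>{2..<CARD('n)}. g k * int (CARD('n) choose k))"
proof -
  let ?F = "{I::'n set. 2 \<le> card I \<and> card I < CARD('n)}"
  have "(\<Sum>I\<in>?F. g (card I)) = (\<Sum>k\<in>{2..<CARD('n)}. \<Sum>I\<in>{I\<in>?F. card I = k}. g (card I))"
    by (rule sum.group [symmetric]) auto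
  also have "\<dots> = (\<Sum>k\<in>{2..<CARD('n)}. g k * int (CARD('n) choose k))"
  proof (rule sum.cong [OF refl])
    fix k assume k: "k \<in> {2..<CARD('n)}"
    then have "{I\<in>?F. card I = k} = {I. I \<subseteq> UNIV \<and> card I = k}" by auto
    then show "(\<Sum>I\<in>{I\<in>?F. card I = k}. g (card I)) = g k * int (CARD('n) choose k)"
      using n_subsets [of "UNIV :: 'n set" k] by simp
  qed
  finally show ?thesis .
qed

lemma field_degree_scale:
  fixes \<phi> :: "real^'n \<Rightarrow> real^'n"
  assumes n: "CARD('n) \<ge> 2" and \<phi>: "nonzero_field \<phi>" and r: "r > 0"
  shows "nonzero_field (\<lambda>x. r *\<^sub>R \<phi> x)" "field_degree (\<lambda>x. r *\<^sub>R \<phi> x) = field_degree \<phi>"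
proof -
  show nz: "nonzero_field (\<lambda>x. r *\<^sub>R \<phi> x)"
  proof (rule nonzero_fieldI)
    show "continuous_on simplex_boundary (\<lambda>x. r *\<^sub>R \<phi> x)"
      using \<phi> by (intro continuous_intros) (simp add: nonzero_field_def)
  qed (use r nonzero_fieldD [OF \<phi>] in auto)
  show "field_degree (\<lambda>x. r *\<^sub>R \<phi> x) = field_degree \<phi>"
  proof (rule field_degree_homotopy [OF n nz \<phi>])
    fix x :: "real^'n" and t :: real
    assume x: "x \<in> simplex_boundary" and t: "0 \<le> t" "t \<le> 1"
    have "(1 - t) * r + t > 0"
    proof (cases "t = 0")
      case False
      then show ?thesis using t r by (intro add_nonneg_pos) auto
    qed (use r in simp)
    then have "((1 - t) * r + t) *\<^sub>R \<phi> x \<noteq> 0"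
      using nonzero_fieldD(2) [OF \<phi> x] by simp
    then show "(1 - t) *\<^sub>R (r *\<^sub>R \<phi> x) + t *\<^sub>R \<phi> x \<noteq> 0"
      by (simp add: scaleR_left_distrib)
  qed
qed

lemma compact_simplex_boundary: "compact (simplex_boundary :: (real^'n) set)"
proof -
  have "simplex_boundary = (\<Inter>i. {t::real^'n. 0 \<le> t $ i}) \<inter> {t. (\<Sum>i\<in>UNIV. t $ i) = 1} \<inter> (\<Union>i. {t. t $ i = 0})"
    by (auto simp: simplex_boundary_def unit_simplex_def)
  moreover have "closed \<dots>"
    by (intro closed_Int closed_INT closed_UN ballI closed_Collect_eq closed_Collect_le
        continuous_intros finite)
  moreover have "norm t \<le> 1" if "t \<in> simplex_boundary" for t :: "real^'n"
    using that norm_le_l1_cart [of t] by (simp add: simplex_boundary_def unit_simplex_def)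
  ultimately show ?thesis
    by (metis compact_eq_bounded_closed boundedI)
qed

text \<open>By compactness the field is bounded by some \<open>B\<close>. Multiplied by
  \<open>1 / (n * B)\<close> it changes each coordinate \<open>1/n\<close> of the center by at most
  \<open>1/n\<close>, so the map stays in the simplex; degree and equivariance survive the
  scaling.\<close>

lemma exists_map_linking_number_zero:
  fixes \<phi> :: "real^'n::{finite,linorder} \<Rightarrow> real^'n::{finite,linorder}"
  assumes n: "CARD('n) \<ge> 2" and \<phi>: "nonzero_field \<phi>" and deg: "field_degree \<phi> = 0"
    and equi: "\<And>I J Z x. I \<noteq> {} \<Longrightarrow> I \<noteq> UNIV \<Longrightarrow> card I = card J \<Longrightarrow> bij_betw Z (- I) (- J) \<Longrightarrow>
      x \<in> simplex_face I \<Longrightarrow> \<phi> (face_sigma I J Z x) = face_sigma I J Z (\<phi> x)"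
  shows "\<exists>f :: real^'n::{finite,linorder} \<Rightarrow> real^'n::{finite,linorder}.
    continuous_on simplex_boundary f \<and>
    f ` simplex_boundary \<subseteq> unit_simplex \<and>
    simplex_center \<notin> f ` simplex_boundary \<and>
    pseudo_equivariant f \<and>
    linking_number f = 0"
proof -
  let ?c = "simplex_center :: real^'n::{finite,linorder}"
  have cont: "continuous_on simplex_boundary \<phi>" using \<phi> by (simp add: nonzero_field_def)
  have "bounded (\<phi> ` simplex_boundary)"
    by (intro compact_imp_bounded compact_continuous_image cont compact_simplex_boundary)
  then obtain B where B: "B > 0" "\<And>x. x \<in> simplex_boundary \<Longrightarrow> norm (\<phi> x) \<le> B"
    unfolding bounded_pos by auto
  define r where "r = 1 / (real CARD('n) * B)"
  have r: "r > 0" using B by (simp add: r_def)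
  note scale = field_degree_scale [OF n \<phi> r]
  define f where "f x = ?c + r *\<^sub>R \<phi> x" for x
  have sigma: "face_sigma I J Z = permute_coords (face_perm I J Z)" for I J :: "'n set" and Z
    by (simp add: fun_eq_iff face_sigma_def permute_coords_def)
  have "f x \<in> unit_simplex" if x: "x \<in> simplex_boundary" for x
  proof -
    have "f x $ i \<ge> 0" for i
    proof -
      have "\<bar>\<phi> x $ i\<bar> \<le> B" using component_le_norm_cart [of "\<phi> x" i] B(2) [OF x] by linarith
      then have "r * \<bar>\<phi> x $ i\<bar> \<le> r * B" using r by (intro mult_left_mono) auto
      also have "r * B = 1 / real CARD('n)" using B by (simp add: r_def)
      finally have "\<bar>r * \<phi> x $ i\<bar> \<le> 1 / real CARD('n)" using r by (simp add: abs_mult)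
      then show ?thesis by (simp add: f_def simplex_center_def)
    qed
    moreover have "(\<Sum>i\<in>UNIV. r * \<phi> x $ i) = 0"
      using nonzero_fieldD(1) [OF \<phi> x] by (simp add: sum_zero_def flip: sum_distrib_left)
    then have "(\<Sum>i\<in>UNIV. f x $ i) = 1"
      by (simp add: f_def simplex_center_def sum.distrib)
    ultimately show ?thesis by (simp add: unit_simplex_def)
  qed
  moreover have "?c \<noteq> f x" if "x \<in> simplex_boundary" for x
    using nonzero_fieldD(2) [OF scale(1) that] by (simp add: f_def)
  moreover have "continuous_on simplex_boundary f"
    unfolding f_def by (intro continuous_intros cont)
  moreover have "pseudo_equivariant f"
    unfolding pseudo_equivariant_def
  proof (intro allI impI ballI, elim conjE)
    fix I J :: "'n set" and Z and x :: "real^'n::{finite,linorder}"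
    assume "I \<noteq> {}" "I \<noteq> UNIV" "card I = card J" "bij_betw Z (- I) (- J)" "x \<in> simplex_face I"
    from equi [OF this] show "f (face_sigma I J Z x) = face_sigma I J Z (f x)"
      by (simp add: f_def sigma linear_add [OF linear_permute_coords]
          linear_scale [OF linear_permute_coords])
  qed
  moreover have "linking_number f = 0"
    using scale(2) deg by (simp add: field_degree_def f_def [abs_def])
  ultimately show ?thesis
    by (intro exI [of _ f] conjI) auto
qed

lemma permute_coords_face:
  assumes "bij \<pi>" "x \<in> simplex_face K"
  shows "permute_coords \<pi> x \<in> simplex_face (\<pi> ` K)"
proof -
  have "(\<Sum>j\<in>UNIV. x $ inv_into UNIV \<pi> j) = (\<Sum>i\<in>UNIV. x $ i)"
    by (rule sum.reindex_bij_betw [of "inv_into UNIV \<pi>" UNIV UNIV "\<lambda>i. x $ i"])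
      (rule bij_imp_bij_inv [OF assms(1)])
  moreover have "inv_into UNIV \<pi> j \<notin> K" if "j \<notin> \<pi> ` K" for j
    using that assms(1) by (metis bij_inv_eq_iff imageI)
  ultimately show ?thesis
    using assms(2) by (simp add: simplex_face_def unit_simplex_def permute_coords_def)
qed

theorem theorem4p3:
  assumes "CARD('n) \<ge> 2" and "\<not> primepow CARD('n)"
  shows "\<exists>f :: real^'n::{finite,linorder} \<Rightarrow> real^'n::{finite,linorder}.
    continuous_on simplex_boundary f \<and>
    f ` simplex_boundary \<subseteq> unit_simplex \<and>
    simplex_center \<notin> f ` simplex_boundary \<and>
    pseudo_equivariant f \<and>
    linking_number f = 0"
proof -
  let ?n = "CARD('n)" and ?c = "simplex_center :: real^'n::{finite,linorder}"
  obtain a :: "nat \<Rightarrow> int" where a: "(\<Sum>k\<in>{2..<?n}. a k * int (?n choose k)) = - 1"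
    using binomial_combination [OF assms] by blast
  \<comment> \<open>A common bound on the coefficients, so that all levels \<open>m\<close> used
    below satisfy \<open>m < M\<close>.\<close>
  define M where "M = (\<Sum>k<?n. nat \<bar>a k\<bar>)"
  have M: "nat \<bar>a k\<bar> \<le> M" if "k < ?n" for k
    unfolding M_def using that by (intro member_le_sum) auto
  define \<F> :: "'n set set" where "\<F> = {I. 2 \<le> card I \<and> card I < ?n}"
  \<comment> \<open>A face with \<open>k\<close> vertices carries \<open>\<bar>a k\<bar>\<close>
    bumps. The sign of \<open>a k\<close> decides in \<open>D\<close> whether each raises or lowers
    the degree by 1.\<close>
  define \<Theta> where "\<Theta> = (SIGMA I:\<F>. {..<nat \<bar>a (card I)\<bar>})"
  define D :: "'n set \<times> nat \<Rightarrow> real^'n::{finite,linorder} \<Rightarrow> real^'n::{finite,linorder}"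
    where "D = (\<lambda>(I, m). bump M I m (a (card I) > 0))"
  define \<phi> where "\<phi> x = x - ?c + (\<Sum>\<theta>\<in>\<Theta>. D \<theta> x)" for x
  have fin: "finite \<F>" "finite \<Theta>" by (simp_all add: \<Theta>_def)
  have index: "bump_index M I m" if "(I, m) \<in> \<Theta>" for I m
    using that M [of "card I"] by (auto simp: \<Theta>_def \<F>_def bump_index_def)
  have nz: "nonzero_field (\<lambda>x. x - ?c + D \<theta> x)" if "\<theta> \<in> \<Theta>" for \<theta>
    using that bump_index.field_degree_bump_eq(1) [OF index] by (cases \<theta>) (simp add: D_def)
  have deg: "field_degree (\<lambda>x. x - ?c + D (I, m) x) - 1 = sgn (a (card I))" if "(I, m) \<in> \<Theta>" for I m
  proof -
    have "a (card I) \<noteq> 0" using that by (auto simp: \<Theta>_def)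
    then show ?thesis
      using bump_index.field_degree_bump_eq(2) [OF index [OF that]] by (simp add: D_def sgn_if)
  qed
  have "disjoint_family_on (\<lambda>(I, m). bump_support M I m) \<Theta>"
    unfolding disjoint_family_on_def using bump_support_disjoint index by fastforce
  then have sum: "nonzero_field \<phi>"
    "field_degree \<phi> = 1 + (\<Sum>\<theta>\<in>\<Theta>. field_degree (\<lambda>x. x - ?c + D \<theta> x) - 1)"
    using field_degree_disjoint_sum [OF assms(1) fin(2) nz, where C = "\<lambda>(I, m). bump_support M I m"]
    by (auto simp: \<phi>_def [abs_def] D_def closed_bump_support bump_eq_0)
  have "(\<Sum>\<theta>\<in>\<Theta>. field_degree (\<lambda>x. x - ?c + D \<theta> x) - 1) = (\<Sum>(I, m)\<in>\<Theta>. sgn (a (card I)))"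
    by (rule sum.cong) (use deg in auto)
  also have "\<dots> = (\<Sum>I\<in>\<F>. \<Sum>m<nat \<bar>a (card I)\<bar>. sgn (a (card I)))"
    unfolding \<Theta>_def by (rule sum.Sigma [symmetric]) auto
  also have "\<dots> = (\<Sum>I\<in>\<F>. a (card I))"
    by (simp add: abs_mult_sgn)
  also have "\<dots> = - 1"
    unfolding \<F>_def using sum_over_subsets_by_card [where 'n = 'n, of a] a by simp
  finally have "field_degree \<phi> = 0" using sum(2) by simp
  moreover have "\<phi> (face_sigma K L Z x) = face_sigma K L Z (\<phi> x)"
    if K: "card K = card L" "bij_betw Z (- K) (- L)" and x: "x \<in> simplex_face K" for K L Z x
  proof -
    let ?\<pi> = "face_perm K L Z"
    note \<pi> = face_perm(1-3) [OF K]
    have inj: "inj ?\<pi>" using \<pi>(1) by (rule bij_is_inj)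
    have sigma: "face_sigma K L Z = permute_coords ?\<pi>"
      by (simp add: fun_eq_iff face_sigma_def permute_coords_def)
    have im: "?\<pi> ` K = L" using \<pi>(2) by (simp add: bij_betw_def)
    \<comment> \<open>By \<open>support_face\<close> only these bumps can be nonzero on the face of
      \<open>U\<close>.\<close>
    define \<Theta>' where "\<Theta>' U = {\<theta> \<in> \<Theta>. fst \<theta> \<subseteq> U}" for U
    have restrict: "(\<Sum>\<theta>\<in>\<Theta>. D \<theta> y) = (\<Sum>\<theta>\<in>\<Theta>' U. D \<theta> y)" if "y \<in> simplex_face U" for y U
    proof (rule sum.mono_neutral_right [OF fin(2)])
      show "\<forall>\<theta>\<in>\<Theta> - \<Theta>' U. D \<theta> y = 0"
        using bump_index.support_face [OF index _ that] bump_eq_0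
        by (fastforce simp: \<Theta>'_def D_def)
    qed (auto simp: \<Theta>'_def)
    have card: "card (?\<pi> ` I) = card I" for I by (meson card_image inj inj_on_subset subset_UNIV)
    \<comment> \<open>Subsets of \<open>K\<close> correspond to subsets of \<open>L\<close> of the
      same cardinality, hence with the same coefficient and the same levels.\<close>
    have "bij_betw (map_prod (image ?\<pi>) id) (\<Theta>' K) (\<Theta>' L)"
    proof (rule bij_betw_imageI)
      show "inj_on (map_prod (image ?\<pi>) id) (\<Theta>' K)"
        using inj by (auto simp: inj_on_def inj_image_eq_iff)
      have "\<theta> \<in> map_prod (image ?\<pi>) id ` \<Theta>' K" if "\<theta> \<in> \<Theta>' L" for \<theta>
      proof -
        obtain J m where J: "\<theta> = (J, m)" by (cases \<theta>)
        then have "J \<subseteq> ?\<pi> ` K" using that im by (simp add: \<Theta>'_def)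
        then obtain I where "I \<subseteq> K" "J = ?\<pi> ` I" by (meson subset_imageE)
        then have "(I, m) \<in> \<Theta>' K" "\<theta> = map_prod (image ?\<pi>) id (I, m)"
          using that J by (auto simp: \<Theta>'_def \<Theta>_def \<F>_def card)
        then show ?thesis by blast
      qed
      moreover have "map_prod (image ?\<pi>) id \<theta> \<in> \<Theta>' L" if "\<theta> \<in> \<Theta>' K" for \<theta>
        using that im by (cases \<theta>) (auto simp: \<Theta>'_def \<Theta>_def \<F>_def card)
      ultimately show "map_prod (image ?\<pi>) id ` \<Theta>' K = \<Theta>' L"
        by (intro equalityI image_subsetI subsetI)
    qed
    moreover have "D (map_prod (image ?\<pi>) id \<theta>) (permute_coords ?\<pi> x) = permute_coords ?\<pi> (D \<theta> x)"
      if "\<theta> \<in> \<Theta>' K" for \<theta>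
    proof -
      obtain I m where I: "\<theta> = (I, m)" by (cases \<theta>)
      then have "strict_mono_on I ?\<pi>" "I \<noteq> {}"
        using that \<pi>(3) by (auto simp: \<Theta>'_def \<Theta>_def \<F>_def strict_mono_on_def)
      then show ?thesis using permute_bump [OF \<pi>(1)] by (simp add: I D_def card)
    qed
    ultimately have "(\<Sum>\<theta>\<in>\<Theta>' L. D \<theta> (permute_coords ?\<pi> x)) = (\<Sum>\<theta>\<in>\<Theta>' K. permute_coords ?\<pi> (D \<theta> x))"
      by (subst sum.reindex_bij_betw [symmetric]) (auto intro: sum.cong)
    then have "(\<Sum>\<theta>\<in>\<Theta>. D \<theta> (permute_coords ?\<pi> x)) = permute_coords ?\<pi> (\<Sum>\<theta>\<in>\<Theta>. D \<theta> x)"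
      using restrict [OF x] restrict [OF permute_coords_face [OF \<pi>(1) x, unfolded im]]
      by (simp add: linear_sum [OF linear_permute_coords])
    then show ?thesis
      by (simp add: \<phi>_def sigma linear_add [OF linear_permute_coords]
          linear_diff [OF linear_permute_coords])
  qed
  ultimately show ?thesis
    using exists_map_linking_number_zero [OF assms(1) sum(1)] by blast
qed

end
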